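(* Let $n\ge 1$, let $A,B\in\mathbf{P}_n$ be positive definite matrices with $[A,B]\neq 0$, and let $p>1$ be a real number. Then $$\delta_p(A,B)>\|\log(A)-\log(B)\|_p .$$
   Context: $\mathbf{P}_n=\mathbf{P}_{n\times n}(\mathbb{C})$ denotes the set of $n\times n$ complex positive definite (Hermitian) matrices. $[A,B]=AB-BA$. For $1<p<\infty$, $\|X\|_p=(\operatorname{Tr}|X|^p)^{1/p}$ is the Schatten $p$-norm, i.e. the $\ell^p$ norm of the singular values of $X$. $\log$ is the matrix logarithm of a positive definite matrix (by functional calculus). The distance $\delta_p$ on $\mathbf{P}_n$ is $$\delta_p(A,B)=\left\|\log\left(A^{-1/2}BA^{-1/2}\right)\right\|_p ,$$ which is the geodesic distance, i.e. the infimum of $\int_0^1\|\gamma(t)^{-1/2}\gamma'(t)\gamma(t)^{-1/2}\|_p\,dt$ over smooth curves $\gamma:[0,1]\to\mathbf{P}_n$ with $\gamma(0)=A$, $\gamma(1)=B$. *)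

theory Defs
  imports "HOL-Analysis.Analysis"
begin

type_synonym 'n cmat = "complex ^ 'n ^ 'n"

definition adjoint_mat :: "'n::finite cmat \<Rightarrow> 'n cmat" where
  "adjoint_mat A = (\<chi> i j. cnj (A $ j $ i))"

definition hermitian :: "'n::finite cmat \<Rightarrow> bool" where
  "hermitian A \<longleftrightarrow> adjoint_mat A = A"

definition unitary :: "'n::finite cmat \<Rightarrow> bool" where
  "unitary U \<longleftrightarrow> adjoint_mat U ** U = mat 1 \<and> U ** adjoint_mat U = mat 1"

text \<open>For Hermitian matrices the quadratic form is real-valued, so taking the real part
  loses nothing.\<close>

definition pos_def :: "'n::finite cmat \<Rightarrow> bool" where
  "pos_def A \<longleftrightarrow> hermitian A \<and>
     (\<forall>x :: complex ^ 'n. x \<noteq> 0 \<longrightarrow> 0 < Re (\<Sum>i\<in>UNIV. cnj (x $ i) * (A *v x) $ i))"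

definition commutator :: "'n::finite cmat \<Rightarrow> 'n cmat \<Rightarrow> 'n cmat" where
  "commutator A B = A ** B - B ** A"

definition real_diag :: "('n::finite \<Rightarrow> real) \<Rightarrow> 'n cmat" where
  "real_diag d = (\<chi> i j. if i = j then complex_of_real (d i) else 0)"

text \<open>Functional calculus for Hermitian matrices: if \<open>A = U diag(d) U\<^sup>*\<close> with \<open>U\<close> unitary
  and \<open>d\<close> real, then \<open>f(A) = U diag(f(d)) U\<^sup>*\<close>. The result does not depend on the chosen
  diagonalisation (lemma \<open>herm_fun_diag\<close> below). The value is unspecified for
  matrices that are not Hermitian.\<close>

definition herm_fun :: "(real \<Rightarrow> real) \<Rightarrow> 'n::finite cmat \<Rightarrow> 'n cmat" where
  "herm_fun f A = (THE X. \<exists>U d. unitary U \<and> A = U ** real_diag d ** adjoint_mat U \<and>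
     X = U ** real_diag (\<lambda>i. f (d i)) ** adjoint_mat U)"

lemma real_diag_mult_left: "(real_diag d ** (W :: 'n::finite cmat)) $ i $ j = of_real (d i) * W $ i $ j"
  by (simp add: real_diag_def matrix_matrix_mult_def if_distrib[of "\<lambda>x. x * _"] cong: if_cong)

lemma real_diag_mult_right: "((W :: 'n::finite cmat) ** real_diag d) $ i $ j = W $ i $ j * of_real (d j)"
  by (simp add: real_diag_def matrix_matrix_mult_def if_distrib[of "\<lambda>x. _ * x"] cong: if_cong)

lemma herm_fun_unique:
  fixes U V :: "'n::finite cmat"
  assumes U: "unitary U" and V: "unitary V"
    and eq: "U ** real_diag d ** adjoint_mat U = V ** real_diag e ** adjoint_mat V"
  shows "U ** real_diag (\<lambda>i. f (d i)) ** adjoint_mat U =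
         V ** real_diag (\<lambda>i. f (e i)) ** adjoint_mat V"
proof -
  define W where "W = adjoint_mat V ** U"
  have UU: "adjoint_mat U ** U = mat 1" "U ** adjoint_mat U = mat 1"
    and VV: "adjoint_mat V ** V = mat 1" "V ** adjoint_mat V = mat 1"
    using U V by (auto simp: unitary_def)
  have VW: "V ** W = U"
    by (simp add: W_def matrix_mul_assoc VV)
  have WU: "W ** adjoint_mat U = adjoint_mat V"
    by (simp add: W_def matrix_mul_assoc[symmetric] UU)
  have "adjoint_mat V ** (U ** real_diag d ** adjoint_mat U) ** U =
        adjoint_mat V ** (V ** real_diag e ** adjoint_mat V) ** U"
    by (simp add: eq)
  moreover have "adjoint_mat V ** (U ** real_diag d ** adjoint_mat U) ** U =
      W ** real_diag d ** (adjoint_mat U ** U)"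
    by (simp add: W_def matrix_mul_assoc)
  moreover have "adjoint_mat V ** (V ** real_diag e ** adjoint_mat V) ** U =
      (adjoint_mat V ** V) ** real_diag e ** W"
    by (simp only: W_def matrix_mul_assoc)
  ultimately have "W ** real_diag d = real_diag e ** W"
    by (simp add: UU VV)
  then have "W $ i $ j * of_real (d j) = of_real (e i) * W $ i $ j" for i j
    by (metis real_diag_mult_left real_diag_mult_right)
  then have "W $ i $ j = 0 \<or> d j = e i" for i j
    by (metis mult.commute mult_cancel_left of_real_eq_iff)
  then have "W $ i $ j * of_real (f (d j)) = of_real (f (e i)) * W $ i $ j" for i j
    by (metis mult.commute mult_zero_left)
  then have "W ** real_diag (\<lambda>i. f (d i)) = real_diag (\<lambda>i. f (e i)) ** W"
    by (simp add: vec_eq_iff real_diag_mult_left real_diag_mult_right)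
  then have "V ** (W ** real_diag (\<lambda>i. f (d i))) ** adjoint_mat U =
      V ** (real_diag (\<lambda>i. f (e i)) ** W) ** adjoint_mat U"
    by simp
  then show ?thesis
    by (metis VW WU matrix_mul_assoc)
qed

lemma herm_fun_diag:
  assumes "unitary U"
  shows "herm_fun f (U ** real_diag d ** adjoint_mat U) =
         U ** real_diag (\<lambda>i. f (d i)) ** adjoint_mat U"
  unfolding herm_fun_def
proof (rule the_equality)
  show "\<exists>V e. unitary V \<and> U ** real_diag d ** adjoint_mat U = V ** real_diag e ** adjoint_mat V \<and>
      U ** real_diag (\<lambda>i. f (d i)) ** adjoint_mat U =
      V ** real_diag (\<lambda>i. f (e i)) ** adjoint_mat V"
    using assms by blast
next
  fix X
  assume "\<exists>V e. unitary V \<and> U ** real_diag d ** adjoint_mat U = V ** real_diag e ** adjoint_mat V \<and>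
      X = V ** real_diag (\<lambda>i. f (e i)) ** adjoint_mat V"
  then show "X = U ** real_diag (\<lambda>i. f (d i)) ** adjoint_mat U"
    using herm_fun_unique[OF assms] by metis
qed

definition mat_log :: "'n::finite cmat \<Rightarrow> 'n cmat" where
  "mat_log A = herm_fun ln A"

definition mat_powr :: "'n::finite cmat \<Rightarrow> real \<Rightarrow> 'n cmat" where
  "mat_powr A r = herm_fun (\<lambda>x. x powr r) A"

definition mat_abs :: "'n::finite cmat \<Rightarrow> 'n cmat" where
  "mat_abs X = herm_fun sqrt (adjoint_mat X ** X)"

definition schatten_norm :: "real \<Rightarrow> 'n::finite cmat \<Rightarrow> real" where
  "schatten_norm p X = Re (trace (mat_powr (mat_abs X) p)) powr (1 / p)"

definition delta :: "real \<Rightarrow> 'n::finite cmat \<Rightarrow> 'n cmat \<Rightarrow> real" where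
  "delta p A B = schatten_norm p (mat_log (mat_powr A (- 1 / 2) ** B ** mat_powr A (- 1 / 2)))"

end

theory Submission
  imports Defs "HOL-Real_Asymp.Real_Asymp"
begin

text \<open>Write \<open>H = log A\<close>, \<open>K = log B\<close>, \<open>D = K - H\<close>, \<open>L = log (A^(-1/2) B A^(-1/2))\<close> and
\<open>f x = |x|\<^sup>p\<close>. Since \<open>||X||\<^sub>p\<^sup>p = Tr f(X)\<close> for Hermitian \<open>X\<close>, the claim is \<open>Tr f(D) < Tr f(L)\<close>. The only facts about
\<open>f\<close> that matter are that it is even and strictly convex, and they enter through Klein's inequality
\<open>Tr f(X) \<ge> Tr f(Y) + Tr (f'(Y) (X - Y))\<close>, with equality only for \<open>X = Y\<close> (\<open>klein_inequality\<close>,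
\<open>klein_equality\<close>).

Infinitesimally the inequality says that the differential of the logarithm contracts the norm. The argument
works with finite differences of an exact form instead. For Hermitian \<open>P\<close>, \<open>Q\<close> with eigenvalues
\<open>p\<^sub>i\<close>, \<open>q\<^sub>j\<close>, the matrix \<open>N = exp(P/2) exp(-Q/2) - exp(-P/2) exp(Q/2)\<close> is
obtained from \<open>P - Q\<close> by multiplying the entry at \<open>(i, j)\<close>, taken between the two eigenbases, by
\<open>2 sinh (x/2) / x\<close> with \<open>x = p\<^sub>i - q\<^sub>j\<close>. Euler's product turns this factor into
\<open>\<Prod>\<^sub>k (1 + x\<^sup>2 / (4 \<pi>\<^sup>2 k\<^sup>2))\<close>. Multiplying by one factor \<open>1 + c x\<^sup>2\<close> adds a double commutator,
which pairs nonnegatively with \<open>f'\<close> of the matrix because \<open>f'\<close> is increasing, so by Klein no factor decreases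
\<open>Tr f\<close> (\<open>trace_fun_quadratic_multiplier\<close>, \<open>trace_fun_sinh_multiplier\<close>). On the other hand the
singular values of \<open>N\<close> are those of \<open>2 sinh (L/2)\<close>, where \<open>L\<close> is the Hermitian matrix that
measures the step from \<open>exp Q\<close> to \<open>exp P\<close> (\<open>geodesic_step_factorization\<close>). Hence
\<open>Tr f(P - Q) \<le> Tr f(2 sinh (L/2))\<close> (\<open>sinh_comparison\<close>).

Cutting the geodesic from \<open>A\<close> to \<open>B\<close> into \<open>m\<close> equal steps replaces \<open>L\<close> by \<open>L/m\<close>, and convexity gives
\<open>Tr f(D) \<le> Tr f(2m sinh (L/2m))\<close>, which tends to \<open>Tr f(L)\<close> (\<open>exponential_metric_increasing\<close>).
If equality held, strict convexity would force the logarithm to be affine along the geodesic, that is,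
\<open>H + D/m\<close> would be the logarithm of the point at parameter \<open>1/m\<close> (\<open>log_linear_of_equality\<close>). For that first step the factor
\<open>1 + x\<^sup>2 / (4 \<pi>\<^sup>2)\<close> alone contributes a surplus proportional to \<open>Tr (f'(D) [H, [H, D]])\<close> in the
limit, and there is no room for one. The trace is a sum of nonnegative terms; their vanishing makes \<open>H\<close> commute with \<open>D\<close> and \<open>A\<close> with \<open>B\<close>
(\<open>commute_of_equality\<close>).\<close>

section \<open>Adjoints and unitary matrices\<close>

lemma adjoint_mat_nth: "adjoint_mat A $ i $ j = cnj (A $ j $ i)"
  by (simp add: adjoint_mat_def)

lemma adjoint_mat_adjoint_mat [simp]: "adjoint_mat (adjoint_mat A) = A"
  by (simp add: vec_eq_iff adjoint_mat_nth)

lemma adjoint_mat_mult: "adjoint_mat (A ** B) = adjoint_mat B ** adjoint_mat A"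
  by (simp add: vec_eq_iff adjoint_mat_nth matrix_matrix_mult_def mult.commute)

lemma adjoint_mat_diff: "adjoint_mat (A - B) = adjoint_mat A - adjoint_mat B"
  by (simp add: vec_eq_iff adjoint_mat_nth)

lemma adjoint_mat_add: "adjoint_mat (A + B) = adjoint_mat A + adjoint_mat B"
  by (simp add: vec_eq_iff adjoint_mat_nth)

lemma adjoint_mat_scaleR: "adjoint_mat (c *\<^sub>R A) = c *\<^sub>R adjoint_mat A"
  by (simp add: vec_eq_iff adjoint_mat_nth)

lemma adjoint_mat_real_diag [simp]: "adjoint_mat (real_diag d) = real_diag d"
  by (simp add: vec_eq_iff adjoint_mat_nth real_diag_def)

lemma adjoint_mat_one [simp]: "adjoint_mat (mat 1) = mat 1"
  by (simp add: vec_eq_iff adjoint_mat_nth mat_def)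

lemma unitary_left: "unitary U \<Longrightarrow> adjoint_mat U ** U = mat 1"
  and unitary_right: "unitary U \<Longrightarrow> U ** adjoint_mat U = mat 1"
  by (auto simp: unitary_def)

lemma unitaryI: "adjoint_mat U ** U = mat 1 \<Longrightarrow> unitary U"
  by (simp add: unitary_def matrix_left_right_inverse)

lemma unitary_mult: "unitary U \<Longrightarrow> unitary V \<Longrightarrow> unitary (U ** V)"
proof (rule unitaryI)
  assume U: "unitary U" and V: "unitary V"
  have "adjoint_mat (U ** V) ** (U ** V) = adjoint_mat V ** (adjoint_mat U ** U) ** V"
    by (simp add: adjoint_mat_mult matrix_mul_assoc)
  then show "adjoint_mat (U ** V) ** (U ** V) = mat 1"
    by (simp add: unitary_left U V)
qed

lemma unitary_adjoint_mat: "unitary U \<Longrightarrow> unitary (adjoint_mat U)"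
  by (simp add: unitary_def)

lemma unitary_one: "unitary (mat 1)"
  by (simp add: unitary_def)

lemma hermitian_nth: "hermitian A \<Longrightarrow> A $ j $ i = cnj (A $ i $ j)"
  by (metis adjoint_mat_nth hermitian_def)

text \<open>This is why the squared moduli of the entries of a unitary matrix serve as weights of an average, over rows as
well as over columns, in the trace inequalities below.\<close>
lemma unitary_entry_sum:
  fixes W :: "'n::finite cmat"
  assumes "unitary W"
  shows "(\<Sum>i\<in>UNIV. (cmod (W $ i $ j))\<^sup>2) = 1" and "(\<Sum>j\<in>UNIV. (cmod (W $ i $ j))\<^sup>2) = 1"
proof -
  have "complex_of_real (\<Sum>i\<in>UNIV. (cmod (W $ i $ j))\<^sup>2) = (adjoint_mat W ** W) $ j $ j"
    unfolding matrix_matrix_mult_def adjoint_mat_nth of_real_sum complex_norm_square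
    by (simp add: adjoint_mat_nth mult.commute)
  then show "(\<Sum>i\<in>UNIV. (cmod (W $ i $ j))\<^sup>2) = 1"
    using unitary_left[OF assms] by (simp add: mat_def del: of_real_sum)
  have "complex_of_real (\<Sum>j\<in>UNIV. (cmod (W $ i $ j))\<^sup>2) = (W ** adjoint_mat W) $ i $ i"
    unfolding matrix_matrix_mult_def adjoint_mat_nth of_real_sum complex_norm_square
    by (simp add: adjoint_mat_nth mult.commute)
  then show "(\<Sum>j\<in>UNIV. (cmod (W $ i $ j))\<^sup>2) = 1"
    using unitary_right[OF assms] by (simp add: mat_def del: of_real_sum)
qed

lemma compact_unitary: "compact {U :: 'n::finite cmat. unitary U}"
proof -
  have 1: "closed {U :: 'n cmat. unitary U}"
    unfolding unitary_def
    by (intro closed_Collect_conj closed_Collect_eq)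
       (simp_all add: matrix_matrix_mult_def adjoint_mat_def continuous_on_vec_lambda continuous_on_sum
         continuous_on_mult continuous_on_cnj continuous_on_component continuous_on_id continuous_on_const)
  have "norm U \<le> real CARD('n)" if "unitary U" for U :: "'n cmat"
  proof -
    have "norm (U $ i) = 1" for i
      using unitary_entry_sum(2)[OF that, of i] by (simp add: norm_vec_def L2_set_def)
    moreover have "norm U \<le> (\<Sum>i\<in>UNIV. norm (U $ i))"
      unfolding norm_vec_def by (rule L2_set_le_sum) auto
    ultimately show ?thesis by simp
  qed
  then have "bounded {U :: 'n cmat. unitary U}"
    by (auto simp: bounded_iff)
  with 1 show ?thesis by (simp add: compact_eq_bounded_closed)
qed

section \<open>Diagonalization of Hermitian matrices\<close>

definition plane_rotation :: "'n \<Rightarrow> 'n \<Rightarrow> real \<Rightarrow> real \<Rightarrow> complex \<Rightarrow> 'n::finite cmat" where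
  "plane_rotation a b c s \<omega> = (\<chi> k j.
     if j = a then (if k = a then of_real c else if k = b then of_real s * \<omega> else 0)
     else if j = b then (if k = a then - of_real s * cnj \<omega> else if k = b then of_real c else 0)
     else if k = j then 1 else 0)"

lemma sum_UNIV_pair:
  fixes h :: "'n::finite \<Rightarrow> complex"
  assumes "a \<noteq> b" "\<And>k. k \<noteq> a \<Longrightarrow> k \<noteq> b \<Longrightarrow> h k = 0"
  shows "sum h UNIV = h a + h b"
proof -
  have "sum h UNIV = sum h {a, b}"
    by (rule sum.mono_neutral_right) (use assms in auto)
  then show ?thesis using assms by simp
qed

lemma sum_UNIV_single:
  fixes h :: "'n::finite \<Rightarrow> complex"
  assumes "\<And>k. k \<noteq> a \<Longrightarrow> h k = 0"
  shows "sum h UNIV = h a"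
proof -
  have "sum h UNIV = sum h {a}"
    by (rule sum.mono_neutral_right) (use assms in auto)
  then show ?thesis by simp
qed

lemma unitary_plane_rotation:
  assumes "a \<noteq> b" and w: "cnj \<omega> * \<omega> = 1" and cs: "c\<^sup>2 + s\<^sup>2 = 1"
  shows "unitary (plane_rotation a b c s \<omega>)"
proof (rule unitaryI)
  let ?R = "plane_rotation a b c s \<omega>"
  have cs': "of_real c * of_real c + of_real s * \<omega> * (of_real s * cnj \<omega>) = (1::complex)"
  proof -
    have "of_real s * \<omega> * (of_real s * cnj \<omega>) = of_real s * of_real s * (cnj \<omega> * \<omega>)" by simp
    also have "of_real c * of_real c + \<dots> = complex_of_real (c\<^sup>2 + s\<^sup>2)"
      unfolding w by (simp add: power2_eq_square)
    also have "\<dots> = 1" unfolding cs by (rule of_real_1)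
    finally show ?thesis .
  qed
  have "(\<Sum>k\<in>UNIV. cnj (?R $ k $ i) * ?R $ k $ j) = (if i = j then 1 else 0)" for i j
  proof -
    consider "i \<in> {a,b}" | "i \<notin> {a,b}" by blast
    then show ?thesis
    proof cases
      case 1
      then have "(\<Sum>k\<in>UNIV. cnj (?R $ k $ i) * ?R $ k $ j)
          = cnj (?R $ a $ i) * ?R $ a $ j + cnj (?R $ b $ i) * ?R $ b $ j"
        by (intro sum_UNIV_pair assms(1)) (auto simp: plane_rotation_def)
      also have "\<dots> = (if i = j then 1 else 0)"
      proof -
        have "of_real s * cnj \<omega> * (of_real s * \<omega>) = of_real s * \<omega> * (of_real s * cnj \<omega>)" by simp
        note cs'' = cs'[folded this]
        have cs1: "of_real s * \<omega> * (of_real s * cnj \<omega>) + of_real c * of_real c = (1::complex)"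
          by (subst add.commute) (rule cs')
        consider "i = a" "j = a" | "i = a" "j = b" | "i = b" "j = a" | "i = b" "j = b"
          | "i = a \<or> i = b" "j \<noteq> a" "j \<noteq> b" using 1 by blast
        then show ?thesis
        proof cases
          case 1 then show ?thesis using assms(1) cs'' by (simp add: plane_rotation_def)
        next
          case 2 then show ?thesis using assms(1) by (simp add: plane_rotation_def)
        next
          case 3 then show ?thesis using assms(1) by (simp add: plane_rotation_def)
        next
          case 4 then show ?thesis using assms(1) cs1 by (simp add: plane_rotation_def)
        next
          case 5 then show ?thesis using assms(1) by (auto simp: plane_rotation_def)
        qed
      qed
      finally show ?thesis .
    next
      case 2
      then have "(\<Sum>k\<in>UNIV. cnj (?R $ k $ i) * ?R $ k $ j) = cnj (?R $ i $ i) * ?R $ i $ j"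
        by (intro sum_UNIV_single) (auto simp: plane_rotation_def)
      also have "\<dots> = (if i = j then 1 else 0)"
        using 2 by (auto simp: plane_rotation_def)
      finally show ?thesis .
    qed
  qed
  then show "adjoint_mat ?R ** ?R = mat 1"
    by (simp add: vec_eq_iff matrix_matrix_mult_def adjoint_mat_nth mat_def)
qed

lemma conj_diagonal_entry:
  "(adjoint_mat R ** M ** R) $ i $ i = (\<Sum>l\<in>UNIV. (\<Sum>k\<in>UNIV. cnj (R $ k $ i) * M $ k $ l) * R $ l $ i)"
  by (simp add: matrix_matrix_mult_def adjoint_mat_nth)

lemma plane_rotation_diagonal:
  fixes M :: "'n::finite cmat" and c s :: real
  assumes M: "hermitian M" and ab: "a \<noteq> b" and w: "cnj \<omega> * \<omega> = 1"
  defines "N \<equiv> adjoint_mat (plane_rotation a b c s \<omega>) ** M ** plane_rotation a b c s \<omega>"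
  shows "Re (N $ a $ a) = c\<^sup>2 * Re (M $ a $ a) + s\<^sup>2 * Re (M $ b $ b) + 2 * c * s * Re (\<omega> * M $ a $ b)"
    and "Re (N $ b $ b) = s\<^sup>2 * Re (M $ a $ a) + c\<^sup>2 * Re (M $ b $ b) - 2 * c * s * Re (\<omega> * M $ a $ b)"
    and "i \<noteq> a \<Longrightarrow> i \<noteq> b \<Longrightarrow> N $ i $ i = M $ i $ i"
proof -
  let ?R = "plane_rotation a b c s \<omega>"
  have inner: "(\<Sum>k\<in>UNIV. cnj (?R $ k $ i) * M $ k $ l) = cnj (?R $ a $ i) * M $ a $ l + cnj (?R $ b $ i) * M $ b $ l"
    if "i = a \<or> i = b" for i l
    by (rule sum_UNIV_pair[OF ab]) (use that in \<open>auto simp: plane_rotation_def\<close>)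
  have N2: "N $ i $ i = (cnj (?R $ a $ i) * M $ a $ a + cnj (?R $ b $ i) * M $ b $ a) * ?R $ a $ i
      + (cnj (?R $ a $ i) * M $ a $ b + cnj (?R $ b $ i) * M $ b $ b) * ?R $ b $ i" if "i = a \<or> i = b" for i
    unfolding N_def conj_diagonal_entry inner[OF that]
    by (rule sum_UNIV_pair[OF ab]) (use that in \<open>auto simp: plane_rotation_def\<close>)
  have ba: "M $ b $ a = cnj (M $ a $ b)" by (rule hermitian_nth[OF M])
  have w': "(Re \<omega>)\<^sup>2 + (Im \<omega>)\<^sup>2 = 1"
    using w by (simp add: complex_eq_iff power2_eq_square)
  have im: "Im (M $ b $ b) = 0" "Im (M $ a $ a) = 0"
    using hermitian_nth[OF M, of a a] hermitian_nth[OF M, of b b] by (auto simp: complex_eq_iff)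
  have "Re (N $ a $ a) = c\<^sup>2 * Re (M $ a $ a) + s\<^sup>2 * ((Re \<omega>)\<^sup>2 + (Im \<omega>)\<^sup>2) * Re (M $ b $ b)
     + 2 * c * s * Re (\<omega> * M $ a $ b)"
    using ab im by (simp add: N2 ba plane_rotation_def algebra_simps power2_eq_square)
  then show "Re (N $ a $ a) = c\<^sup>2 * Re (M $ a $ a) + s\<^sup>2 * Re (M $ b $ b) + 2 * c * s * Re (\<omega> * M $ a $ b)"
    by (simp add: w')
  have "Re (N $ b $ b) = s\<^sup>2 * ((Re \<omega>)\<^sup>2 + (Im \<omega>)\<^sup>2) * Re (M $ a $ a) + c\<^sup>2 * Re (M $ b $ b)
     - 2 * c * s * Re (\<omega> * M $ a $ b)"
    using ab im by (simp add: N2 ba plane_rotation_def algebra_simps power2_eq_square)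
  then show "Re (N $ b $ b) = s\<^sup>2 * Re (M $ a $ a) + c\<^sup>2 * Re (M $ b $ b) - 2 * c * s * Re (\<omega> * M $ a $ b)"
    by (simp add: w')
  assume i: "i \<noteq> a" "i \<noteq> b"
  have "(\<Sum>k\<in>UNIV. cnj (?R $ k $ i) * M $ k $ l) = cnj (?R $ i $ i) * M $ i $ l" for l
    by (rule sum_UNIV_single) (use i in \<open>auto simp: plane_rotation_def\<close>)
  then have "N $ i $ i = (\<Sum>l\<in>UNIV. (cnj (?R $ i $ i) * M $ i $ l) * ?R $ l $ i)"
    unfolding N_def conj_diagonal_entry by simp
  also have "\<dots> = (cnj (?R $ i $ i) * M $ i $ i) * ?R $ i $ i"
    by (rule sum_UNIV_single) (use i in \<open>auto simp: plane_rotation_def\<close>)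
  finally show "N $ i $ i = M $ i $ i"
    using i by (simp add: plane_rotation_def)
qed

lemma hermitian_conj: "hermitian A \<Longrightarrow> hermitian (V ** A ** adjoint_mat V)"
  by (simp add: hermitian_def adjoint_mat_mult matrix_mul_assoc)

text \<open>A unitary \<open>U\<close> is chosen to maximize \<open>\<Sum>\<^sub>i w\<^sub>i (U\<^sup>* A U)\<^sub>i\<^sub>i\<close> for pairwise distinct weights
\<open>w\<^sub>i\<close>; it exists by compactness. If \<open>U\<^sup>* A U\<close> had a nonzero entry at \<open>(a, b)\<close> off the diagonal, rotating in the
plane of \<open>a\<close> and \<open>b\<close> would move weight between the two diagonal entries at a nonzero rate, in either direction.\<close>
lemma hermitian_diagonalization:
  fixes A :: "'n::finite cmat"
  assumes A: "hermitian A"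
  obtains U d where "unitary U" "A = U ** real_diag d ** adjoint_mat U"
proof -
  obtain w :: "'n \<Rightarrow> nat" where w: "inj w"
    using finite_imp_inj_to_nat_seg[OF finite[of "UNIV :: 'n set"]] by auto
  define h where "h U = (\<Sum>i\<in>UNIV. real (w i) * Re ((adjoint_mat U ** A ** U) $ i $ i))" for U :: "'n cmat"
  have "continuous_on {U. unitary U} h"
  proof -
    have "continuous_on {U :: 'n cmat. unitary U} (\<lambda>U. adjoint_mat U ** A ** U)"
      by (simp add: matrix_matrix_mult_def adjoint_mat_def continuous_on_vec_lambda continuous_on_sum
         continuous_on_mult continuous_on_cnj continuous_on_component continuous_on_id continuous_on_const)
    then show ?thesis
      unfolding h_def by (intro continuous_intros) auto
  qed
  moreover have "{U :: 'n cmat. unitary U} \<noteq> {}" using unitary_one by blast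
  ultimately obtain U where U: "unitary U" and max: "\<And>V. unitary V \<Longrightarrow> h V \<le> h U"
    using continuous_attains_sup[OF compact_unitary] by (metis mem_Collect_eq)
  define M where "M = adjoint_mat U ** A ** U"
  have M: "hermitian M"
    using hermitian_conj[OF A, of "adjoint_mat U"] by (simp add: M_def)
  have off: "M $ a $ b = 0" if ab: "a \<noteq> b" for a b
  proof (rule ccontr)
    assume nz: "M $ a $ b \<noteq> 0"
    define r where "r = cmod (M $ a $ b)"
    \<comment> \<open>The phase that makes \<open>\<omega> * M $ a $ b\<close> real and positive.\<close>
    define \<omega> where "\<omega> = cnj (M $ a $ b) / r"
    have r: "r > 0" using nz by (simp add: r_def)
    have rr: "complex_of_real r * complex_of_real r = M $ a $ b * cnj (M $ a $ b)"
      unfolding r_def by (simp add: complex_norm_square[symmetric] power2_eq_square flip: of_real_mult)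
    have om: "cnj \<omega> * \<omega> = 1"
      using r by (simp add: \<omega>_def rr[symmetric])
    have "\<omega> * M $ a $ b = (complex_of_real r * complex_of_real r) / r"
      unfolding rr by (simp add: \<omega>_def)
    then have "\<omega> * M $ a $ b = r" using r by simp
    then have omr: "Re (\<omega> * M $ a $ b) = r" by simp
    \<comment> \<open>The change of the weighted trace under the rotation by the angle \<open>t\<close>.\<close>
    define \<phi> where "\<phi> t = (real (w a) - real (w b)) *
        ((sin t)\<^sup>2 * (Re (M $ b $ b) - Re (M $ a $ a)) + 2 * cos t * sin t * r)" for t
    have "\<phi> t \<le> 0" for t
    proof -
      let ?R = "plane_rotation a b (cos t) (sin t) \<omega>"
      let ?N = "adjoint_mat ?R ** M ** ?R"
      note N = plane_rotation_diagonal[OF M ab om, where c = "cos t" and s = "sin t", unfolded omr]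
      have "adjoint_mat (U ** ?R) ** A ** (U ** ?R) = ?N"
        by (simp add: M_def adjoint_mat_mult matrix_mul_assoc)
      then have "(\<Sum>i\<in>UNIV. real (w i) * Re (?N $ i $ i)) \<le> (\<Sum>i\<in>UNIV. real (w i) * Re (M $ i $ i))"
        using max[OF unitary_mult[OF U unitary_plane_rotation[OF ab om, of "cos t" "sin t"]]]
        by (simp add: h_def M_def)
      then have "0 \<ge> (\<Sum>i\<in>UNIV. real (w i) * (Re (?N $ i $ i) - Re (M $ i $ i)))"
        by (simp add: sum_subtractf right_diff_distrib)
      also have "(\<Sum>i\<in>UNIV. real (w i) * (Re (?N $ i $ i) - Re (M $ i $ i)))
          = (\<Sum>i\<in>{a,b}. real (w i) * (Re (?N $ i $ i) - Re (M $ i $ i)))"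
        by (rule sum.mono_neutral_right) (auto simp: N(3))
      also have "\<dots> = \<phi> t"
        using ab unfolding \<phi>_def by (simp add: N(1,2) cos_squared_eq algebra_simps)
      finally show ?thesis .
    qed
    moreover have "\<phi> 0 = 0" by (simp add: \<phi>_def)
    moreover have "(\<phi> has_real_derivative (real (w a) - real (w b)) * (2 * r)) (at 0)"
      unfolding \<phi>_def by (auto intro!: derivative_eq_intros)
    ultimately have "(real (w a) - real (w b)) * (2 * r) = 0"
      by (intro DERIV_local_max[where d = 1]) auto
    then show False using r w ab by (simp add: inj_eq)
  qed
  have real: "M $ i $ i = of_real (Re (M $ i $ i))" for i
    using hermitian_nth[OF M, of i i] by (simp add: complex_eq_iff)
  have "M = real_diag (\<lambda>i. Re (M $ i $ i))"
    using off real by (auto simp: vec_eq_iff real_diag_def)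
  then have "U ** real_diag (\<lambda>i. Re (M $ i $ i)) ** adjoint_mat U = U ** M ** adjoint_mat U" by simp
  also have "\<dots> = (U ** adjoint_mat U) ** A ** (U ** adjoint_mat U)"
    by (simp add: M_def matrix_mul_assoc)
  also have "\<dots> = A" by (simp add: unitary_right[OF U])
  finally show ?thesis using that[OF U] by metis
qed

section \<open>Functional calculus\<close>

lemma matrix_diff_ldistrib: "A ** (B - C) = A ** B - A ** (C :: 'a::ring_1 ^ 'n ^ 'm)"
  by (simp add: vec_eq_iff matrix_matrix_mult_def right_diff_distrib sum_subtractf)

lemma matrix_diff_rdistrib: "(B - C) ** A = B ** A - (C :: 'a::ring_1 ^ 'n ^ 'm) ** A"
  by (simp add: vec_eq_iff matrix_matrix_mult_def left_diff_distrib sum_subtractf)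

lemma matrix_add_rdistrib: "(B + C) ** A = B ** A + (C :: 'a::ring_1 ^ 'n ^ 'm) ** A"
  by (simp add: vec_eq_iff matrix_matrix_mult_def distrib_right sum.distrib)

lemma matrix_mult_scaleR: "A ** (c *\<^sub>R B) = c *\<^sub>R (A ** (B :: 'a::real_algebra_1 ^ 'n ^ 'm))"
  "(c *\<^sub>R A) ** B = c *\<^sub>R (A ** B)"
  by (simp_all add: vec_eq_iff matrix_matrix_mult_def scaleR_sum_right)

lemma trace_scaleR: "trace (c *\<^sub>R A) = c *\<^sub>R trace (A :: 'a::real_algebra_1 ^ 'n ^ 'n)"
  by (simp add: trace_def scaleR_sum_right)

lemma hermitian_real_diag: "hermitian (real_diag d)"
  by (simp add: hermitian_def)

lemma hermitian_diagonal_form: "hermitian (U ** real_diag d ** adjoint_mat U)"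
  by (rule hermitian_conj[OF hermitian_real_diag])

lemma hermitian_add: "hermitian A \<Longrightarrow> hermitian B \<Longrightarrow> hermitian (A + B)"
  and hermitian_diff: "hermitian A \<Longrightarrow> hermitian B \<Longrightarrow> hermitian (A - B)"
  and hermitian_scaleR: "hermitian A \<Longrightarrow> hermitian (c *\<^sub>R A)"
  by (simp_all add: hermitian_def adjoint_mat_add adjoint_mat_diff adjoint_mat_scaleR)

lemma real_diag_mult: "real_diag d ** real_diag e = real_diag (\<lambda>i. d i * e i)"
  by (simp add: vec_eq_iff real_diag_mult_left) (simp add: real_diag_def)

lemma real_diag_diff: "real_diag d - real_diag e = real_diag (\<lambda>i. d i - e i)"
  by (simp add: vec_eq_iff real_diag_def)

lemma real_diag_scaleR: "c *\<^sub>R real_diag d = real_diag (\<lambda>i. c * d i)"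
  by (simp add: vec_eq_iff real_diag_def) (simp add: scaleR_conv_of_real)

lemma real_diag_one: "real_diag (\<lambda>i. 1) = mat 1"
  by (simp add: vec_eq_iff real_diag_def mat_def)

lemma unitary_cancel:
  assumes "unitary U"
  shows "adjoint_mat U ** (U ** A) = A" "U ** (adjoint_mat U ** A) = A"
    "A ** adjoint_mat U ** U = A" "A ** U ** adjoint_mat U = A"
  using assms by (simp_all add: unitary_def matrix_mul_assoc flip: matrix_mul_assoc[of A])

lemma hermitian_herm_fun: "hermitian A \<Longrightarrow> hermitian (herm_fun f A)"
  by (metis hermitian_diagonalization herm_fun_diag hermitian_diagonal_form)

lemma herm_fun_herm_fun:
  assumes "hermitian A"
  shows "herm_fun f (herm_fun g A) = herm_fun (\<lambda>x. f (g x)) A"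
proof -
  obtain U d where "unitary U" "A = U ** real_diag d ** adjoint_mat U"
    using hermitian_diagonalization[OF assms] .
  then show ?thesis by (simp add: herm_fun_diag)
qed

lemma herm_fun_mult:
  assumes "hermitian A"
  shows "herm_fun f A ** herm_fun g A = herm_fun (\<lambda>x. f x * g x) A"
proof -
  obtain U d where U: "unitary U" "A = U ** real_diag d ** adjoint_mat U"
    using hermitian_diagonalization[OF assms] .
  have "herm_fun f A ** herm_fun g A
      = U ** real_diag (\<lambda>i. f (d i)) ** (adjoint_mat U ** U) ** real_diag (\<lambda>i. g (d i)) ** adjoint_mat U"
    by (simp add: U herm_fun_diag matrix_mul_assoc)
  also have "\<dots> = U ** (real_diag (\<lambda>i. f (d i)) ** real_diag (\<lambda>i. g (d i))) ** adjoint_mat U"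
    by (simp add: unitary_left U matrix_mul_assoc)
  finally show ?thesis by (simp add: real_diag_mult U herm_fun_diag)
qed

lemma herm_fun_diff:
  assumes "hermitian A"
  shows "herm_fun f A - herm_fun g A = herm_fun (\<lambda>x. f x - g x) A"
proof -
  obtain U d where U: "unitary U" "A = U ** real_diag d ** adjoint_mat U"
    using hermitian_diagonalization[OF assms] .
  then show ?thesis
    by (simp add: U herm_fun_diag flip: matrix_diff_ldistrib matrix_diff_rdistrib real_diag_diff)
qed

lemma herm_fun_scaleR:
  assumes "hermitian A"
  shows "herm_fun (\<lambda>x. c * f x) A = c *\<^sub>R herm_fun f A"
proof -
  obtain U d where U: "unitary U" "A = U ** real_diag d ** adjoint_mat U"
    using hermitian_diagonalization[OF assms] .
  then show ?thesis
    by (simp add: U herm_fun_diag matrix_mult_scaleR flip: real_diag_scaleR)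
qed

lemma herm_fun_ident:
  assumes "hermitian A"
  shows "herm_fun (\<lambda>x. x) A = A"
proof -
  obtain U d where U: "unitary U" "A = U ** real_diag d ** adjoint_mat U"
    using hermitian_diagonalization[OF assms] .
  then show ?thesis by (simp add: herm_fun_diag)
qed

lemma herm_fun_one:
  assumes "hermitian A"
  shows "herm_fun (\<lambda>x. 1) A = mat 1"
proof -
  obtain U d where U: "unitary U" "A = U ** real_diag d ** adjoint_mat U"
    using hermitian_diagonalization[OF assms] .
  then show ?thesis
    by (simp add: U herm_fun_diag real_diag_one unitary_right)
qed

lemma herm_fun_conj:
  assumes A: "hermitian A" and V: "unitary V"
  shows "herm_fun f (V ** A ** adjoint_mat V) = V ** herm_fun f A ** adjoint_mat V"
proof -
  obtain U d where U: "unitary U" "A = U ** real_diag d ** adjoint_mat U"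
    using hermitian_diagonalization[OF A] .
  have "V ** A ** adjoint_mat V = (V ** U) ** real_diag d ** adjoint_mat (V ** U)"
    by (simp add: U adjoint_mat_mult matrix_mul_assoc)
  then have "herm_fun f (V ** A ** adjoint_mat V)
      = (V ** U) ** real_diag (\<lambda>i. f (d i)) ** adjoint_mat (V ** U)"
    by (simp add: herm_fun_diag[OF unitary_mult[OF V U(1)]])
  then show ?thesis by (simp add: U herm_fun_diag adjoint_mat_mult matrix_mul_assoc)
qed

definition trace_fun :: "(real \<Rightarrow> real) \<Rightarrow> 'n::finite cmat \<Rightarrow> real" where
  "trace_fun f X = Re (trace (herm_fun f X))"

text \<open>The real inner product of Hermitian matrices.\<close>
definition trace_pair :: "'n::finite cmat \<Rightarrow> 'n cmat \<Rightarrow> real" where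
  "trace_pair X Y = Re (trace (X ** Y))"

lemma trace_pair_commute: "trace_pair X Y = trace_pair Y X"
  unfolding trace_pair_def by (subst trace_mul_sym) simp

lemma trace_pair_diff: "trace_pair X (Y - Z) = trace_pair X Y - trace_pair X Z"
  by (simp add: trace_pair_def matrix_diff_ldistrib trace_sub)

lemma trace_pair_add: "trace_pair X (Y + Z) = trace_pair X Y + trace_pair X Z"
  by (simp add: trace_pair_def matrix_add_ldistrib trace_add)

lemma trace_pair_scaleR: "trace_pair X (c *\<^sub>R Y) = c * trace_pair X Y"
  by (simp add: trace_pair_def matrix_mult_scaleR trace_scaleR)

lemma trace_unitary_conj: "unitary U \<Longrightarrow> trace (U ** X ** adjoint_mat U) = trace X"
  by (subst trace_mul_sym) (simp add: matrix_mul_assoc unitary_left)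

lemma trace_fun_diag:
  "unitary U \<Longrightarrow> trace_fun f (U ** real_diag d ** adjoint_mat U) = (\<Sum>i\<in>UNIV. f (d i))"
  by (simp add: trace_fun_def herm_fun_diag trace_unitary_conj) (simp add: trace_def real_diag_def)

lemma trace_fun_herm_fun:
  "hermitian A \<Longrightarrow> trace_fun f (herm_fun g A) = trace_fun (\<lambda>x. f (g x)) A"
  by (simp add: trace_fun_def herm_fun_herm_fun)

lemma trace_fun_conj:
  "hermitian A \<Longrightarrow> unitary V \<Longrightarrow> trace_fun f (V ** A ** adjoint_mat V) = trace_fun f A"
  by (simp add: trace_fun_def herm_fun_conj trace_unitary_conj)

section \<open>Klein's inequality\<close>

text \<open>Between the eigenbases \<open>U\<close> and \<open>V\<close>, the pairing is an average of the products of the eigenvalues, weighted by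
the squared overlaps of the eigenvectors. This reduces trace inequalities to scalar ones.\<close>
lemma trace_pair_diag:
  fixes U V :: "'n::finite cmat"
  shows "trace_pair (U ** real_diag x ** adjoint_mat U) (V ** real_diag y ** adjoint_mat V)
    = (\<Sum>i\<in>UNIV. \<Sum>j\<in>UNIV. (cmod ((adjoint_mat U ** V) $ i $ j))\<^sup>2 * (x i * y j))"
proof -
  let ?W = "adjoint_mat U ** V"
  have "trace ((U ** real_diag x ** adjoint_mat U) ** (V ** real_diag y ** adjoint_mat V))
      = trace (U ** (real_diag x ** ?W ** real_diag y ** adjoint_mat V))"
    by (simp add: matrix_mul_assoc)
  also have "\<dots> = trace ((real_diag x ** ?W ** real_diag y ** adjoint_mat V) ** U)"
    by (rule trace_mul_sym)
  also have "\<dots> = trace ((real_diag x ** ?W ** real_diag y) ** adjoint_mat ?W)"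
    by (simp add: matrix_mul_assoc adjoint_mat_mult)
  also have "\<dots> = (\<Sum>i\<in>UNIV. \<Sum>j\<in>UNIV. of_real (x i) * ?W $ i $ j * of_real (y j) * cnj (?W $ i $ j))"
    unfolding trace_def matrix_matrix_mult_def[of "_ ** real_diag y"]
    by (simp add: real_diag_mult_left real_diag_mult_right adjoint_mat_nth)
  also have "\<dots> = of_real (\<Sum>i\<in>UNIV. \<Sum>j\<in>UNIV. (cmod (?W $ i $ j))\<^sup>2 * (x i * y j))"
    unfolding of_real_sum of_real_mult complex_norm_square by (simp add: mult_ac)
  finally show ?thesis unfolding trace_pair_def by simp
qed

text \<open>The overlaps sum to 1 in each row and in each column, so \<open>Tr f(X)\<close> and \<open>Tr f(Y)\<close> can be written as averages with
the same weights as the pairing.\<close>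
lemma klein_gap:
  fixes X Y :: "'n::finite cmat"
  assumes U: "unitary U" and X: "X = U ** real_diag x ** adjoint_mat U"
    and V: "unitary V" and Y: "Y = V ** real_diag y ** adjoint_mat V"
  shows "trace_fun f X - trace_fun f Y - trace_pair (herm_fun g Y) (X - Y)
    = (\<Sum>i\<in>UNIV. \<Sum>j\<in>UNIV. (cmod ((adjoint_mat U ** V) $ i $ j))\<^sup>2 * (f (x i) - f (y j) - g (y j) * (x i - y j)))"
proof -
  let ?w = "\<lambda>i j. (cmod ((adjoint_mat U ** V) $ i $ j))\<^sup>2"
  note w = unitary_entry_sum[OF unitary_mult[OF unitary_adjoint_mat[OF U] V]]
  have 1: "trace_fun f X = (\<Sum>i\<in>UNIV. \<Sum>j\<in>UNIV. ?w i j * f (x i))"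
    by (simp add: X trace_fun_diag[OF U] w flip: sum_distrib_right)
  have 2: "(\<Sum>i\<in>UNIV. \<Sum>j\<in>UNIV. ?w i j * h j) = (\<Sum>j\<in>UNIV. h j)" for h
    by (subst sum.swap) (simp add: w flip: sum_distrib_right)
  have 3: "trace_pair (herm_fun g Y) X = (\<Sum>i\<in>UNIV. \<Sum>j\<in>UNIV. ?w i j * (g (y j) * x i))"
    by (subst trace_pair_commute) (simp add: X Y herm_fun_diag[OF V] trace_pair_diag mult.commute[of "g _"])
  have "herm_fun g Y ** Y = herm_fun (\<lambda>t. g t * t) Y"
    using herm_fun_mult[of Y g "\<lambda>t. t"] herm_fun_ident[of Y] hermitian_diagonal_form[of V y] by (simp add: Y)
  then have 4: "trace_pair (herm_fun g Y) Y = (\<Sum>i\<in>UNIV. \<Sum>j\<in>UNIV. ?w i j * (g (y j) * y j))"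
    unfolding trace_pair_def 2 by (simp add: trace_fun_diag[OF V] Y flip: trace_fun_def)
  show ?thesis
    unfolding trace_pair_diff 1 3 4 2[of "\<lambda>j. f (y j)", folded trace_fun_diag[OF V], folded Y, symmetric]
    by (simp add: algebra_simps sum.distrib sum_subtractf)
qed

text \<open>The graph of \<open>f\<close> lies above its supporting line of slope \<open>g y\<close> at every \<open>y\<close>: \<open>f\<close> is convex and \<open>g\<close> selects
subgradients of it.\<close>
definition subgradient :: "(real \<Rightarrow> real) \<Rightarrow> (real \<Rightarrow> real) \<Rightarrow> bool" where
  "subgradient f g \<longleftrightarrow> (\<forall>x y. f y + g y * (x - y) \<le> f x)"

lemma klein_inequality:
  assumes X: "hermitian X" and Y: "hermitian Y" and fg: "subgradient f g"
  shows "trace_fun f Y + trace_pair (herm_fun g Y) (X - Y) \<le> trace_fun f X"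
proof -
  obtain U x where U: "unitary U" "X = U ** real_diag x ** adjoint_mat U"
    using hermitian_diagonalization[OF X] .
  obtain V y where V: "unitary V" "Y = V ** real_diag y ** adjoint_mat V"
    using hermitian_diagonalization[OF Y] .
  have "f (x i) - f (y j) - g (y j) * (x i - y j) \<ge> 0" for i j
    using fg unfolding subgradient_def by (smt (verit))
  then have "trace_fun f X - trace_fun f Y - trace_pair (herm_fun g Y) (X - Y) \<ge> 0"
    unfolding klein_gap[OF U V] by (intro sum_nonneg) simp
  then show ?thesis by simp
qed

text \<open>Equality in Klein's inequality lets only equal eigenvalues overlap. Then the matrix of overlaps intertwines the two diagonal
forms, as in the proof that the functional calculus is independent of the diagonalization.\<close>
lemma klein_equality:
  fixes X Y :: "'n::finite cmat"
  assumes X: "hermitian X" and Y: "hermitian Y"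
    and fg: "\<And>x y. x \<noteq> y \<Longrightarrow> f y + g y * (x - y) < f x"
    and eq: "trace_fun f X \<le> trace_fun f Y + trace_pair (herm_fun g Y) (X - Y)"
  shows "X = Y"
proof -
  obtain U x where U: "unitary U" "X = U ** real_diag x ** adjoint_mat U"
    using hermitian_diagonalization[OF X] .
  obtain V y where V: "unitary V" "Y = V ** real_diag y ** adjoint_mat V"
    using hermitian_diagonalization[OF Y] .
  let ?W = "adjoint_mat U ** V"
  let ?e = "\<lambda>i j. (cmod (?W $ i $ j))\<^sup>2 * (f (x i) - f (y j) - g (y j) * (x i - y j))"
  have pos: "f (x i) - f (y j) - g (y j) * (x i - y j) > 0" if "x i \<noteq> y j" for i j
    using fg[OF that] by simp
  have nn: "?e i j \<ge> 0" for i j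
  proof (cases "x i = y j")
    case False
    show ?thesis by (rule mult_nonneg_nonneg[OF zero_le_power2 less_imp_le[OF pos[OF False]]])
  qed simp
  have "(\<Sum>i\<in>UNIV. \<Sum>j\<in>UNIV. ?e i j) \<le> 0"
    using eq klein_gap[OF U V, of f g] by linarith
  then have "(\<Sum>i\<in>UNIV. \<Sum>j\<in>UNIV. ?e i j) = 0"
    by (intro antisym sum_nonneg nn)
  then have z: "?e i j = 0" for i j
    by (simp add: sum_nonneg_eq_0_iff sum_nonneg nn)
  have "of_real (x i) * ?W $ i $ j = ?W $ i $ j * of_real (y j)" for i j
    using z[of i j] pos[of i j] by (cases "x i = y j") auto
  then have "real_diag x ** ?W = ?W ** real_diag y"
    unfolding vec_eq_iff real_diag_mult_left real_diag_mult_right by blast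
  then have "U ** (real_diag x ** ?W) ** adjoint_mat V = U ** (?W ** real_diag y) ** adjoint_mat V"
    by simp
  moreover have "U ** (real_diag x ** ?W) ** adjoint_mat V = X ** (V ** adjoint_mat V)"
    by (simp add: U matrix_mul_assoc)
  moreover have "U ** (?W ** real_diag y) ** adjoint_mat V = (U ** adjoint_mat U) ** Y"
    by (simp add: V matrix_mul_assoc)
  ultimately show ?thesis by (simp add: unitary_right U(1) V(1))
qed

section \<open>Entrywise multipliers\<close>

lemma subgradient_mono:
  assumes "subgradient f g"
  shows "0 \<le> (x - y) * (g x - g y)"
proof -
  have "f y + g y * (x - y) \<le> f x" "f x + g x * (y - x) \<le> f y"
    using assms by (auto simp: subgradient_def)
  then show ?thesis by (simp add: algebra_simps)
qed

lemma commutator_conj: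
  assumes "unitary V"
  shows "commutator (V ** A ** adjoint_mat V) (V ** B ** adjoint_mat V) = V ** commutator A B ** adjoint_mat V"
proof -
  have "(V ** A ** adjoint_mat V) ** (V ** B ** adjoint_mat V) = V ** (A ** B) ** adjoint_mat V" for A B
    using unitary_cancel(3)[OF assms] by (simp add: matrix_mul_assoc)
  then show ?thesis by (simp add: commutator_def matrix_diff_ldistrib matrix_diff_rdistrib)
qed

lemma trace_pair_conj:
  assumes "unitary V"
  shows "trace_pair (V ** A ** adjoint_mat V) (V ** B ** adjoint_mat V) = trace_pair A B"
proof -
  have "(V ** A ** adjoint_mat V) ** (V ** B ** adjoint_mat V) = V ** (A ** B) ** adjoint_mat V"
    using unitary_cancel(3)[OF assms] by (simp add: matrix_mul_assoc)
  then show ?thesis by (simp add: trace_pair_def trace_unitary_conj[OF assms])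
qed

text \<open>With \<open>[S, diag y]\<^sub>k\<^sub>l = (y\<^sub>l - y\<^sub>k) S\<^sub>k\<^sub>l\<close> the trace is \<open>2 \<Sum> |S\<^sub>k\<^sub>l|\<^sup>2 z\<^sub>k (y\<^sub>k - y\<^sub>l)\<close>; exchanging the
names of \<open>k\<close> and \<open>l\<close> in one half gives the symmetric form.\<close>
lemma double_commutator_pairing_diag:
  fixes S :: "'n::finite cmat"
  assumes S: "hermitian S"
  shows "trace_pair (real_diag z) (commutator S (commutator S (real_diag y)))
    = (\<Sum>k\<in>UNIV. \<Sum>l\<in>UNIV. (cmod (S $ k $ l))\<^sup>2 * ((y k - y l) * (z k - z l)))"
proof -
  let ?a = "\<lambda>k l. (cmod (S $ k $ l))\<^sup>2"
  have C: "commutator S (real_diag y) $ k $ l = of_real (y l - y k) * S $ k $ l" for k l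
    by (simp add: commutator_def real_diag_mult_left real_diag_mult_right algebra_simps)
  have sym: "?a k l = ?a l k" for k l
    using hermitian_nth[OF S, of l k] by simp
  have SS: "S $ k $ l * S $ l $ k = of_real (?a k l)" for k l
    by (simp only: hermitian_nth[OF S, of l k] complex_norm_square)
  have "(real_diag z ** commutator S (commutator S (real_diag y))) $ k $ k
      = of_real (\<Sum>l\<in>UNIV. 2 * (?a k l * (z k * (y k - y l))))" for k
  proof -
    have "(real_diag z ** commutator S (commutator S (real_diag y))) $ k $ k
        = (\<Sum>l\<in>UNIV. of_real (z k) * (S $ k $ l * (of_real (y k - y l) * S $ l $ k) - of_real (y l - y k) * S $ k $ l * S $ l $ k))"
      unfolding real_diag_mult_left commutator_def[of S "commutator _ _"]
      by (simp add: matrix_matrix_mult_def C sum_distrib_left sum_subtractf right_diff_distrib)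
    also have "\<dots> = (\<Sum>l\<in>UNIV. 2 * (S $ k $ l * S $ l $ k * of_real (z k * (y k - y l))))"
      by (intro sum.cong refl) (simp add: algebra_simps)
    finally show ?thesis by (simp add: SS)
  qed
  then have "trace_pair (real_diag z) (commutator S (commutator S (real_diag y)))
      = (\<Sum>k\<in>UNIV. \<Sum>l\<in>UNIV. 2 * (?a k l * (z k * (y k - y l))))"
    unfolding trace_pair_def trace_def by simp
  also have "\<dots> = (\<Sum>k\<in>UNIV. \<Sum>l\<in>UNIV. ?a k l * (z k * (y k - y l))) + (\<Sum>k\<in>UNIV. \<Sum>l\<in>UNIV. ?a k l * (z k * (y k - y l)))"
    by (simp flip: sum_distrib_left)
  also have "\<dots> = (\<Sum>k\<in>UNIV. \<Sum>l\<in>UNIV. ?a k l * (z k * (y k - y l))) + (\<Sum>k\<in>UNIV. \<Sum>l\<in>UNIV. ?a k l * (z l * (y l - y k)))"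
  proof (rule arg_cong[of _ _ "plus _"])
    show "(\<Sum>k\<in>UNIV. \<Sum>l\<in>UNIV. ?a k l * (z k * (y k - y l))) = (\<Sum>k\<in>UNIV. \<Sum>l\<in>UNIV. ?a k l * (z l * (y l - y k)))"
      by (subst sum.swap) (subst sym, rule refl)
  qed
  also have "\<dots> = (\<Sum>k\<in>UNIV. \<Sum>l\<in>UNIV. ?a k l * ((y k - y l) * (z k - z l)))"
    unfolding sum.distrib[symmetric] by (intro sum.cong refl) (simp add: algebra_simps)
  finally show ?thesis .
qed

text \<open>For increasing \<open>g\<close> every summand is nonnegative: this is the source of all inequalities below, and of the
strictness at the end.\<close>
lemma double_commutator_pairing:
  fixes R :: "'n::finite cmat"
  assumes R: "hermitian R" and V: "unitary V" and M: "M = V ** real_diag y ** adjoint_mat V"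
  shows "trace_pair (herm_fun g M) (commutator R (commutator R M))
    = (\<Sum>k\<in>UNIV. \<Sum>l\<in>UNIV. (cmod ((adjoint_mat V ** R ** V) $ k $ l))\<^sup>2 * ((y k - y l) * (g (y k) - g (y l))))"
proof -
  let ?S = "adjoint_mat V ** R ** V"
  have S: "hermitian ?S" using hermitian_conj[OF R, of "adjoint_mat V"] by simp
  have "R = V ** ?S ** adjoint_mat V"
    by (simp add: matrix_mul_assoc unitary_right[OF V] unitary_cancel[OF V])
  then have "commutator R (commutator R M)
      = V ** commutator ?S (commutator ?S (real_diag y)) ** adjoint_mat V"
    by (metis M V commutator_conj)
  then show ?thesis
    unfolding M herm_fun_diag[OF V] by (simp add: trace_pair_conj[OF V] double_commutator_pairing_diag[OF S])
qed

definition schur_multiplier :: "('n \<Rightarrow> 'n \<Rightarrow> real) \<Rightarrow> 'n::finite cmat \<Rightarrow> 'n cmat" where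
  "schur_multiplier m M = (\<chi> i j. of_real (m i j) * M $ i $ j)"

lemma schur_multiplier_quadratic:
  "schur_multiplier (\<lambda>i j. 1 + c * (r i - r j)\<^sup>2) M
    = M + c *\<^sub>R commutator (real_diag r) (commutator (real_diag r) M)"
  by (simp add: vec_eq_iff schur_multiplier_def commutator_def real_diag_mult_left real_diag_mult_right)
     (simp add: scaleR_conv_of_real power2_eq_square algebra_simps)

lemma schur_multiplier_mult:
  "schur_multiplier m (schur_multiplier m' M) = schur_multiplier (\<lambda>i j. m i j * m' i j) M"
  by (simp add: vec_eq_iff schur_multiplier_def mult_ac)

lemma hermitian_schur_multiplier:
  "hermitian M \<Longrightarrow> (\<And>i j. m i j = m j i) \<Longrightarrow> hermitian (schur_multiplier m M)"
  by (auto simp: hermitian_def vec_eq_iff schur_multiplier_def adjoint_mat_nth)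

text \<open>The multiplier adds \<open>c [R, [R, M]]\<close> with \<open>R = diag r\<close>, which pairs nonnegatively with \<open>g(M)\<close>.\<close>
lemma trace_fun_quadratic_multiplier:
  fixes M :: "'n::finite cmat"
  assumes M: "hermitian M" and fg: "subgradient f g" and c: "0 \<le> c"
  shows "trace_fun f M \<le> trace_fun f (schur_multiplier (\<lambda>i j. 1 + c * (r i - r j)\<^sup>2) M)"
proof -
  let ?X = "schur_multiplier (\<lambda>i j. 1 + c * (r i - r j)\<^sup>2) M"
  obtain V y where V: "unitary V" "M = V ** real_diag y ** adjoint_mat V"
    using hermitian_diagonalization[OF M] .
  have X: "hermitian ?X"
    by (rule hermitian_schur_multiplier[OF M]) (simp add: power2_commute)
  have "0 \<le> trace_pair (herm_fun g M) (?X - M)"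
    unfolding schur_multiplier_quadratic
    by (simp add: trace_pair_scaleR double_commutator_pairing[OF hermitian_real_diag V] c
        sum_nonneg subgradient_mono[OF fg])
  with klein_inequality[OF X M fg] show ?thesis by linarith
qed

text \<open>Euler's product for the sine at an imaginary argument.\<close>
lemma sinh_product:
  fixes x :: real
  shows "(\<lambda>n. x * (\<Prod>k=1..n. 1 + 1 / (4 * pi\<^sup>2 * (real k)\<^sup>2) * x\<^sup>2)) \<longlonglongrightarrow> 2 * sinh (x / 2)"
proof -
  define z where "z = \<i> * of_real (x / (2 * pi))"
  have z2: "z\<^sup>2 = - of_real (x\<^sup>2 / (4 * pi\<^sup>2))"
    by (simp add: z_def power_mult_distrib power_divide)
  have pz: "of_real pi * z = \<i> * of_real (x / 2)" by (simp add: z_def)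
  have "(\<lambda>n. of_real pi * z * (\<Prod>k=1..n. 1 - z\<^sup>2 / (of_nat k)\<^sup>2)) \<longlonglongrightarrow> sin (of_real pi * z)"
    by (rule sin_product_formula_complex)
  also have "(\<lambda>n. of_real pi * z * (\<Prod>k=1..n. 1 - z\<^sup>2 / (of_nat k)\<^sup>2))
      = (\<lambda>n. \<i> * of_real (x / 2 * (\<Prod>k=1..n. 1 + 1 / (4 * pi\<^sup>2 * (real k)\<^sup>2) * x\<^sup>2)))"
    unfolding z2 pz by (simp add: mult.assoc)
  also have "sin (of_real pi * z) = \<i> * of_real (sinh (x / 2))"
  proof -
    have "of_real (sinh (x / 2)) = - \<i> * sin (of_real pi * z)"
      unfolding pz sinh_real[symmetric] by (simp add: sinh_field_def exp_minus)
    then show ?thesis by simp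
  qed
  finally have "(\<lambda>n. - \<i> * (\<i> * of_real (x / 2 * (\<Prod>k=1..n. 1 + 1 / (4 * pi\<^sup>2 * (real k)\<^sup>2) * x\<^sup>2))))
      \<longlonglongrightarrow> - \<i> * (\<i> * of_real (sinh (x / 2)))"
    by (rule tendsto_mult_left)
  then have "(\<lambda>n. complex_of_real (x / 2 * (\<Prod>k=1..n. 1 + 1 / (4 * pi\<^sup>2 * (real k)\<^sup>2) * x\<^sup>2)))
      \<longlonglongrightarrow> complex_of_real (sinh (x / 2))"
    by (simp add: mult.assoc[symmetric] del: of_real_mult of_real_prod)
  then have "(\<lambda>n. x / 2 * (\<Prod>k=1..n. 1 + 1 / (4 * pi\<^sup>2 * (real k)\<^sup>2) * x\<^sup>2)) \<longlonglongrightarrow> sinh (x / 2)"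
    by (simp only: tendsto_of_real_iff)
  from tendsto_mult_left[OF this, of 2] show ?thesis by (simp add: mult.assoc)
qed

text \<open>Klein's inequality at the intermediate point, where the two linear terms cancel.\<close>
lemma trace_fun_convex:
  assumes X: "hermitian X" and Y: "hermitian Y" and fg: "subgradient f g" and t: "0 \<le> t" "t \<le> 1"
  shows "trace_fun f ((1 - t) *\<^sub>R X + t *\<^sub>R Y) \<le> (1 - t) * trace_fun f X + t * trace_fun f Y"
proof -
  let ?Z = "(1 - t) *\<^sub>R X + t *\<^sub>R Y"
  let ?G = "herm_fun g ?Z"
  have Z: "hermitian ?Z" by (intro hermitian_add hermitian_scaleR X Y)
  have "(1 - t) * (trace_fun f ?Z + trace_pair ?G (X - ?Z)) \<le> (1 - t) * trace_fun f X"
    "t * (trace_fun f ?Z + trace_pair ?G (Y - ?Z)) \<le> t * trace_fun f Y"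
    using t by (auto intro!: mult_left_mono klein_inequality X Y Z fg)
  moreover have "(1 - t) * trace_pair ?G (X - ?Z) + t * trace_pair ?G (Y - ?Z) = 0"
    by (simp add: trace_pair_diff trace_pair_add trace_pair_scaleR algebra_simps)
  ultimately show ?thesis by (simp add: algebra_simps)
qed

text \<open>A finite convex function on a Euclidean space is continuous.\<close>
lemma trace_fun_tendsto:
  fixes M :: "nat \<Rightarrow> 'n::finite cmat"
  assumes M: "\<And>n. hermitian (M n)" and lim: "M \<longlonglongrightarrow> N" and N: "hermitian N" and fg: "subgradient f g"
  shows "(\<lambda>n. trace_fun f (M n)) \<longlonglongrightarrow> trace_fun f N"
proof -
  \<comment> \<open>The convex function has to live on an open set; the Hermitian part extends it to all matrices.\<close>
  define S where "S X = (1 / 2) *\<^sub>R (X + adjoint_mat X)" for X :: "'n cmat"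
  have S: "hermitian (S X)" for X
    by (simp add: S_def hermitian_def adjoint_mat_scaleR adjoint_mat_add add.commute)
  have S_id: "S X = X" if "hermitian X" for X
    using that by (simp add: S_def hermitian_def flip: scaleR_2)
  have S_lin: "S ((1 - t) *\<^sub>R X + t *\<^sub>R Y) = (1 - t) *\<^sub>R S X + t *\<^sub>R S Y" for t X Y
    by (simp only: S_def adjoint_mat_scaleR adjoint_mat_add scaleR_add_right scaleR_scaleR mult.commute add_ac)
  have "convex_on UNIV (\<lambda>X. trace_fun f (S X))"
    by (rule convex_onI) (use S_lin trace_fun_convex[OF S S fg] in auto)
  then have "continuous_on UNIV (\<lambda>X. trace_fun f (S X))"
    by (rule convex_on_continuous[OF open_UNIV])
  then have "(\<lambda>n. trace_fun f (S (M n))) \<longlonglongrightarrow> trace_fun f (S N)"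
    using lim by (auto intro: continuous_on_tendsto_compose)
  then show ?thesis by (simp add: S_id M N)
qed

lemma tendsto_matrixI:
  fixes M :: "nat \<Rightarrow> 'n::finite cmat"
  assumes "\<And>i j. (\<lambda>n. M n $ i $ j) \<longlonglongrightarrow> N $ i $ j"
  shows "M \<longlonglongrightarrow> N"
  by (intro vec_tendstoI assms)

text \<open>The first factor is kept on the left-hand side, because it alone carries the surplus that makes the final
inequality strict.\<close>
lemma trace_fun_sinh_multiplier:
  fixes M N :: "'n::finite cmat" and r :: "'n \<Rightarrow> real"
  defines "m \<equiv> \<lambda>k i j. 1 + 1 / (4 * pi\<^sup>2 * (real k)\<^sup>2) * (r i - r j)\<^sup>2"
  assumes M: "hermitian M" and N: "hermitian N" and fg: "subgradient f g"
    and lim: "\<And>i j. (\<lambda>n. of_real (\<Prod>k=1..n. m k i j) * M $ i $ j) \<longlonglongrightarrow> N $ i $ j"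
  shows "trace_fun f (schur_multiplier (m 1) M) \<le> trace_fun f N"
proof -
  define X where "X n = schur_multiplier (\<lambda>i j. \<Prod>k=1..n. m k i j) M" for n
  have hX: "hermitian (X n)" for n
    unfolding X_def by (rule hermitian_schur_multiplier[OF M]) (simp add: m_def power2_commute)
  have X_Suc: "X (Suc n) = schur_multiplier (m (Suc n)) (X n)" for n
    by (simp add: X_def schur_multiplier_mult mult.commute)
  have "trace_fun f (X n) \<le> trace_fun f (X (Suc n))" for n
    unfolding X_Suc m_def by (rule trace_fun_quadratic_multiplier[OF hX fg]) simp
  then have "mono (\<lambda>n. trace_fun f (X n))" by (rule mono_iff_le_Suc[THEN iffD2, rule_format])
  moreover have "(\<lambda>n. trace_fun f (X n)) \<longlonglongrightarrow> trace_fun f N"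
    by (rule trace_fun_tendsto[OF hX _ N fg], rule tendsto_matrixI)
       (use lim in \<open>simp add: X_def schur_multiplier_def\<close>)
  ultimately have "trace_fun f (X 1) \<le> trace_fun f N"
    by (rule incseq_le)
  then show ?thesis by (simp add: X_def)
qed

section \<open>Hermitian dilation of a matrix\<close>

definition block :: "'n::finite cmat \<Rightarrow> 'n cmat \<Rightarrow> 'n cmat \<Rightarrow> 'n cmat \<Rightarrow> ('n + 'n) cmat" where
  "block A B C D = (\<chi> r s. case r of
      Inl i \<Rightarrow> (case s of Inl j \<Rightarrow> A $ i $ j | Inr j \<Rightarrow> B $ i $ j)
    | Inr i \<Rightarrow> (case s of Inl j \<Rightarrow> C $ i $ j | Inr j \<Rightarrow> D $ i $ j))"

lemma block_nth [simp]:
  "block A B C D $ Inl i $ Inl j = A $ i $ j" "block A B C D $ Inl i $ Inr j = B $ i $ j"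
  "block A B C D $ Inr i $ Inl j = C $ i $ j" "block A B C D $ Inr i $ Inr j = D $ i $ j"
  by (simp_all add: block_def)

lemma forall_sum: "(\<forall>x. P x) \<longleftrightarrow> (\<forall>a. P (Inl a)) \<and> (\<forall>b. P (Inr b))"
  by (metis obj_sumE)

lemma sum_UNIV_sum: "(\<Sum>x\<in>(UNIV :: ('a::finite + 'b::finite) set). h x) = (\<Sum>a\<in>UNIV. h (Inl a)) + (\<Sum>b\<in>UNIV. h (Inr b))"
  unfolding UNIV_Plus_UNIV[symmetric] by (subst sum.Plus) auto

lemma block_mult:
  "block A B C D ** block A' B' C' D'
    = block (A ** A' + B ** C') (A ** B' + B ** D') (C ** A' + D ** C') (C ** B' + D ** D')"
  by (simp add: vec_eq_iff forall_sum matrix_matrix_mult_def sum_UNIV_sum)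

lemma adjoint_mat_block:
  "adjoint_mat (block A B C D) = block (adjoint_mat A) (adjoint_mat C) (adjoint_mat B) (adjoint_mat D)"
  by (simp add: vec_eq_iff forall_sum adjoint_mat_nth)

lemma trace_block: "trace (block A B C D) = trace A + trace D"
  by (simp add: trace_def sum_UNIV_sum)

lemma block_diff: "block A B C D - block A' B' C' D' = block (A - A') (B - B') (C - C') (D - D')"
  by (simp add: vec_eq_iff forall_sum)

lemma block_one: "block (mat 1) 0 0 (mat 1) = mat 1"
  by (simp add: vec_eq_iff forall_sum mat_def)

lemma real_diag_sum: "real_diag d = block (real_diag (\<lambda>i. d (Inl i))) 0 0 (real_diag (\<lambda>i. d (Inr i)))"
  by (simp add: vec_eq_iff forall_sum real_diag_def)

lemma zero_matrix_mult [simp]: "0 ** (A :: 'n::finite cmat) = 0"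
  by (simp add: vec_eq_iff matrix_matrix_mult_def)

lemma adjoint_mat_zero [simp]: "adjoint_mat 0 = 0"
  by (simp add: vec_eq_iff adjoint_mat_nth)

lemma unitary_block_diag:
  assumes "unitary U" "unitary V"
  shows "unitary (block U 0 0 V)"
  by (rule unitaryI) (simp add: adjoint_mat_block block_mult unitary_left assms block_one)

text \<open>The eigenvalues of this Hermitian matrix are the singular values of \<open>X\<close> and their negatives. It carries the results on Hermitian
matrices over to the matrices taken between the two different eigenbases of \<open>P\<close> and \<open>Q\<close>.\<close>
definition dilation :: "'n::finite cmat \<Rightarrow> ('n + 'n) cmat" where
  "dilation X = block 0 X (adjoint_mat X) 0"

lemma hermitian_dilation: "hermitian (dilation X)"
  by (simp add: hermitian_def dilation_def adjoint_mat_block)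

lemma dilation_conj:
  "block U 0 0 V ** dilation X ** adjoint_mat (block U 0 0 V) = dilation (U ** X ** adjoint_mat V)"
  by (simp add: dilation_def adjoint_mat_block block_mult adjoint_mat_mult matrix_mul_assoc)

lemma trace_fun_dilation_conj:
  assumes "unitary U" "unitary V"
  shows "trace_fun f (dilation (U ** X ** adjoint_mat V)) = trace_fun f (dilation X)"
  unfolding dilation_conj[symmetric]
  by (rule trace_fun_conj[OF hermitian_dilation unitary_block_diag[OF assms]])

lemma trace_adjoint_mat: "trace (adjoint_mat X) = cnj (trace X)"
  by (simp add: trace_def adjoint_mat_nth)

lemma trace_pair_dilation:
  assumes "hermitian G"
  shows "trace_pair (dilation G) (dilation X) = 2 * trace_pair G X"
proof -
  have "trace (G ** adjoint_mat X) = cnj (trace (G ** X))"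
    using assms by (subst trace_mul_sym) (simp add: hermitian_def adjoint_mat_mult flip: trace_adjoint_mat)
  then show ?thesis
    using assms by (simp add: trace_pair_def dilation_def block_mult trace_block hermitian_def)
qed

text \<open>If \<open>D\<close> has eigenvectors \<open>v\<close> with eigenvalues \<open>d\<close>, then its dilation has the eigenvectors \<open>(v, v)\<close> and \<open>(v, -v)\<close>,
normalized by \<open>sqrt (1/2)\<close>, with the eigenvalues \<open>d\<close> and \<open>-d\<close>.\<close>
lemma herm_fun_dilation:
  fixes D :: "'n::finite cmat"
  assumes D: "hermitian D"
  shows "herm_fun h (dilation D) =
    block ((1 / 2) *\<^sub>R herm_fun (\<lambda>x. h x + h (- x)) D) ((1 / 2) *\<^sub>R herm_fun (\<lambda>x. h x - h (- x)) D)
      ((1 / 2) *\<^sub>R herm_fun (\<lambda>x. h x - h (- x)) D) ((1 / 2) *\<^sub>R herm_fun (\<lambda>x. h x + h (- x)) D)"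
proof -
  obtain V d where V: "unitary V" "D = V ** real_diag d ** adjoint_mat V"
    using hermitian_diagonalization[OF D] .
  define r where "r = sqrt (1 / 2)"
  have r2: "r * r = 1 / 2" by (simp add: r_def)
  define Q where "Q = block (r *\<^sub>R V) (r *\<^sub>R V) (r *\<^sub>R V) (- (r *\<^sub>R V))"
  define e where "e = case_sum d (\<lambda>i. - d i)"
  have minus: "A ** (- B) = - (A ** B)" "(- A) ** B = - (A ** B)" "adjoint_mat (- A) = - adjoint_mat A" for A B :: "'n cmat"
    by (simp_all add: vec_eq_iff matrix_matrix_mult_def sum_negf adjoint_mat_nth)
  have Q: "unitary Q"
    unfolding unitary_def
    by (simp add: Q_def adjoint_mat_block block_mult matrix_mult_scaleR adjoint_mat_scaleR minus unitary_left[OF V(1)] unitary_right[OF V(1)] r2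
        flip: scaleR_add_left block_one)
  have form: "Q ** real_diag (\<lambda>i. k (e i)) ** adjoint_mat Q
      = block ((1 / 2) *\<^sub>R herm_fun (\<lambda>x. k x + k (- x)) D) ((1 / 2) *\<^sub>R herm_fun (\<lambda>x. k x - k (- x)) D)
      ((1 / 2) *\<^sub>R herm_fun (\<lambda>x. k x - k (- x)) D) ((1 / 2) *\<^sub>R herm_fun (\<lambda>x. k x + k (- x)) D)" for k
  proof -
    have sum: "herm_fun (\<lambda>x. k x + k (- x)) D = herm_fun k D + herm_fun (\<lambda>x. k (- x)) D"
      using herm_fun_diff[OF D, of "\<lambda>x. k x + k (- x)" "\<lambda>x. k (- x)"] by (simp add: algebra_simps)
    have diff: "herm_fun (\<lambda>x. k x - k (- x)) D = herm_fun k D - herm_fun (\<lambda>x. k (- x)) D"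
      using herm_fun_diff[OF D, of k "\<lambda>x. k (- x)"] by simp
    have kD: "V ** real_diag (\<lambda>i. k (d i)) ** adjoint_mat V = herm_fun k D"
      "V ** real_diag (\<lambda>i. k (- d i)) ** adjoint_mat V = herm_fun (\<lambda>x. k (- x)) D"
      unfolding V(2) herm_fun_diag[OF V(1)] by simp_all
    have rd: "real_diag (\<lambda>i. k (e i)) = block (real_diag (\<lambda>i. k (d i))) 0 0 (real_diag (\<lambda>i. k (- d i)))"
      by (subst real_diag_sum) (simp add: e_def)
    show ?thesis
      by (simp add: rd Q_def adjoint_mat_block block_mult matrix_mult_scaleR adjoint_mat_scaleR
         minus kD r2 sum diff scaleR_add_right scaleR_diff_right)
  qed
  have "dilation D = Q ** real_diag (\<lambda>i. e i) ** adjoint_mat Q"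
    using form[of "\<lambda>x. x"] D herm_fun_scaleR[OF D, of 2 "\<lambda>x. x"] herm_fun_scaleR[OF D, of 0 "\<lambda>x. x"]
    by (simp add: dilation_def hermitian_def herm_fun_ident)
  then have "herm_fun h (dilation D) = Q ** real_diag (\<lambda>i. h (e i)) ** adjoint_mat Q"
    by (simp add: herm_fun_diag[OF Q])
  then show ?thesis unfolding form .
qed

lemma trace_fun_dilation_even:
  assumes D: "hermitian D" and f: "\<And>x. f (- x) = f x"
  shows "trace_fun f (dilation D) = 2 * trace_fun f D"
  using herm_fun_scaleR[OF D, of 2 f]
  by (simp add: trace_fun_def herm_fun_dilation[OF D] f trace_block)

lemma herm_fun_dilation_odd:
  assumes D: "hermitian D" and g: "\<And>x. g (- x) = - g x"
  shows "herm_fun g (dilation D) = dilation (herm_fun g D)"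
  unfolding herm_fun_dilation[OF D]
  using herm_fun_scaleR[OF D, of 2 g] herm_fun_scaleR[OF D, of 0 g] hermitian_herm_fun[OF D, of g]
  by (simp add: g dilation_def hermitian_def)

section \<open>Comparing the difference of logarithms with one geodesic step\<close>

abbreviation herm_exp :: "real \<Rightarrow> 'n::finite cmat \<Rightarrow> 'n cmat" where
  "herm_exp c X \<equiv> herm_fun (\<lambda>x. exp (c * x)) X"

lemma herm_exp_add: "hermitian X \<Longrightarrow> herm_exp a X ** herm_exp b X = herm_exp (a + b) X"
  by (simp add: herm_fun_mult algebra_simps flip: exp_add)

lemma herm_exp_cancel: "hermitian X \<Longrightarrow> a + b = 0 \<Longrightarrow> herm_exp a X ** herm_exp b X = mat 1"
  by (simp add: herm_exp_add herm_fun_one)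

lemma adjoint_herm_fun: "hermitian X \<Longrightarrow> adjoint_mat (herm_fun f X) = herm_fun f X"
  using hermitian_herm_fun[of X f] by (simp add: hermitian_def)

lemma unitaryI_right: "U ** adjoint_mat U = mat 1 \<Longrightarrow> unitary U"
  by (simp add: unitary_def matrix_left_right_inverse)

text \<open>Here \<open>L\<close> describes the step from \<open>exp Q\<close> to \<open>exp P\<close> in the coordinates given by \<open>T\<close>. Both
\<open>W1 = exp(-Q/2) T\<close> and \<open>W2 = exp(-P/2) T exp(L/2)\<close> are unitary, and solving for the
exponentials gives \<open>exp(P/2) exp(-Q/2) = W2 exp(L/2) W1\<^sup>*\<close> and
\<open>exp(-P/2) exp(Q/2) = W2 exp(-L/2) W1\<^sup>*\<close>.\<close>
lemma geodesic_step_factorization: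
  fixes P Q L T :: "'n::finite cmat"
  assumes P: "hermitian P" and Q: "hermitian Q" and L: "hermitian L"
    and eQ: "herm_fun exp Q = T ** adjoint_mat T"
    and eP: "herm_fun exp P = T ** herm_fun exp L ** adjoint_mat T"
  obtains W1 W2 where "unitary W1" "unitary W2"
    "herm_exp (1/2) P ** herm_exp (-1/2) Q - herm_exp (-1/2) P ** herm_exp (1/2) Q
      = W2 ** herm_fun (\<lambda>x. 2 * sinh (x / 2)) L ** adjoint_mat W1"
proof -
  define W1 where "W1 = herm_exp (-1/2) Q ** T"
  define W2 where "W2 = herm_exp (-1/2) P ** T ** herm_exp (1/2) L"
  have sandwich: "herm_exp (-1/2) X ** herm_fun exp X ** herm_exp (-1/2) X = mat 1" if "hermitian X" for X :: "'n cmat"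
    using herm_exp_add[OF that, of "-1/2" 1] herm_exp_cancel[OF that, of "1/2" "-1/2"] by simp
  have Lh: "herm_exp (1/2) L ** herm_exp (1/2) L = herm_fun exp L"
    using herm_exp_add[OF L, of "1/2" "1/2"] by simp
  have "W1 ** adjoint_mat W1 = herm_exp (-1/2) Q ** (T ** adjoint_mat T) ** herm_exp (-1/2) Q"
    by (simp add: W1_def adjoint_mat_mult adjoint_herm_fun Q matrix_mul_assoc)
  then have W1W1: "W1 ** adjoint_mat W1 = mat 1"
    by (simp only: eQ[symmetric] sandwich[OF Q])
  then have W1: "unitary W1" by (rule unitaryI_right)
  have "W2 ** adjoint_mat W2
      = herm_exp (-1/2) P ** (T ** (herm_exp (1/2) L ** herm_exp (1/2) L) ** adjoint_mat T) ** herm_exp (-1/2) P"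
    by (simp add: W2_def adjoint_mat_mult adjoint_herm_fun P L matrix_mul_assoc)
  then have W2W2: "W2 ** adjoint_mat W2 = mat 1"
    by (simp only: Lh eP[symmetric] sandwich[OF P])
  then have W2: "unitary W2" by (rule unitaryI_right)
  have TQ: "T = herm_exp (1/2) Q ** W1"
    using herm_exp_cancel[OF Q, of "1/2" "-1/2"] by (simp add: W1_def matrix_mul_assoc)
  have TP: "herm_exp (1/2) P ** W2 = T ** herm_exp (1/2) L"
    using herm_exp_cancel[OF P, of "1/2" "-1/2"] by (simp add: W2_def matrix_mul_assoc)
  have "herm_exp (1/2) P = herm_exp (1/2) P ** W2 ** adjoint_mat W2"
    using unitary_cancel(4)[OF W2] by simp
  also have "\<dots> = T ** herm_exp (1/2) L ** adjoint_mat W2"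
    by (simp only: TP)
  finally have "adjoint_mat (herm_exp (1/2) P) = adjoint_mat (T ** herm_exp (1/2) L ** adjoint_mat W2)"
    by simp
  then have "herm_exp (1/2) P = W2 ** herm_exp (1/2) L ** adjoint_mat T"
    by (simp add: adjoint_mat_mult adjoint_herm_fun P L matrix_mul_assoc)
  also have "adjoint_mat T = adjoint_mat W1 ** herm_exp (1/2) Q"
    by (subst TQ) (simp add: adjoint_mat_mult adjoint_herm_fun Q)
  finally have "herm_exp (1/2) P ** herm_exp (-1/2) Q
      = W2 ** herm_exp (1/2) L ** adjoint_mat W1 ** (herm_exp (1/2) Q ** herm_exp (-1/2) Q)"
    by (simp add: matrix_mul_assoc)
  moreover have "herm_exp (1/2) Q ** herm_exp (-1/2) Q = mat 1"
    by (rule herm_exp_cancel[OF Q]) simp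
  ultimately have 1: "herm_exp (1/2) P ** herm_exp (-1/2) Q = W2 ** herm_exp (1/2) L ** adjoint_mat W1"
    by (simp only: matrix_mul_rid)
  have TQ': "herm_exp (1/2) Q = T ** adjoint_mat W1"
    unfolding TQ by (simp add: unitary_cancel(4)[OF W1])
  have "herm_exp (-1/2) P ** T = W2 ** herm_exp (-1/2) L"
    using herm_exp_cancel[OF L, of "1/2" "-1/2"] by (simp add: W2_def flip: matrix_mul_assoc)
  then have 2: "herm_exp (-1/2) P ** herm_exp (1/2) Q = W2 ** herm_exp (-1/2) L ** adjoint_mat W1"
    unfolding TQ' by (simp add: matrix_mul_assoc)
  have "herm_exp (1/2) L - herm_exp (-1/2) L = herm_fun (\<lambda>x. 2 * sinh (x / 2)) L"
    unfolding herm_fun_diff[OF L] by (simp add: sinh_field_def diff_divide_distrib)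
  then have "W2 ** herm_exp (1/2) L ** adjoint_mat W1 - W2 ** herm_exp (-1/2) L ** adjoint_mat W1
      = W2 ** herm_fun (\<lambda>x. 2 * sinh (x / 2)) L ** adjoint_mat W1"
    by (simp flip: matrix_diff_ldistrib matrix_diff_rdistrib)
  with 1 2 that[OF W1 W2] show ?thesis by simp
qed

text \<open>The square of the derivation \<open>X \<mapsto> P X - X Q\<close>. Between eigenvectors of \<open>P\<close> and \<open>Q\<close> it multiplies the
entry at \<open>(i, j)\<close> by \<open>(p\<^sub>i - q\<^sub>j)\<^sup>2\<close>; for \<open>P = Q\<close> it is the double commutator.\<close>
definition derivation_sq :: "'n::finite cmat \<Rightarrow> 'n cmat \<Rightarrow> 'n cmat \<Rightarrow> 'n cmat" where
  "derivation_sq P Q X = P ** (P ** X - X ** Q) - (P ** X - X ** Q) ** Q"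

text \<open>Between the eigenbases, \<open>P - Q\<close> has the entries \<open>(p\<^sub>i - q\<^sub>j) C\<^sub>i\<^sub>j\<close> with \<open>C\<close> the matrix of overlaps, and the matrix of
\<open>geodesic_step_factorization\<close> has the entries \<open>2 sinh ((p\<^sub>i - q\<^sub>j)/2) C\<^sub>i\<^sub>j\<close>. So the second arises from
the first through the sinh multiplier, applied to the dilations; the matrix \<open>X\<close> is what the first factor of
the product gives.\<close>
lemma sinh_comparison:
  fixes P Q L T :: "'n::finite cmat"
  assumes P: "hermitian P" and Q: "hermitian Q" and L: "hermitian L"
    and eQ: "herm_fun exp Q = T ** adjoint_mat T"
    and eP: "herm_fun exp P = T ** herm_fun exp L ** adjoint_mat T"
    and fg: "subgradient f g" and f: "\<And>x. f (- x) = f x"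
  defines "D \<equiv> P - Q"
  defines "X \<equiv> D + (1 / (4 * pi\<^sup>2)) *\<^sub>R derivation_sq P Q D"
    and "R \<equiv> trace_fun (\<lambda>x. f (2 * sinh (x / 2))) L"
  shows "trace_fun f D \<le> R" and "trace_fun f (dilation X) \<le> 2 * R"
proof -
  obtain U p where U: "unitary U" "P = U ** real_diag p ** adjoint_mat U"
    using hermitian_diagonalization[OF P] .
  obtain V q where V: "unitary V" "Q = V ** real_diag q ** adjoint_mat V"
    using hermitian_diagonalization[OF Q] .
  obtain W1 W2 where W: "unitary W1" "unitary W2"
    "herm_exp (1/2) P ** herm_exp (-1/2) Q - herm_exp (-1/2) P ** herm_exp (1/2) Q
      = W2 ** herm_fun (\<lambda>x. 2 * sinh (x / 2)) L ** adjoint_mat W1"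
    using geodesic_step_factorization[OF P Q L eQ eP] .
  define C where "C = adjoint_mat U ** V"
  have UC: "U ** C = V" by (simp add: C_def unitary_cancel[OF U(1)])
  have CV: "C ** adjoint_mat V = adjoint_mat U" by (simp add: C_def unitary_cancel[OF V(1)])
  define Y where "Y = (\<chi> i j. of_real (p i - q j) * C $ i $ j)"
  define N where "N = (\<chi> i j. of_real (2 * sinh ((p i - q j) / 2)) * C $ i $ j)"
  have D: "hermitian D" unfolding D_def by (rule hermitian_diff[OF P Q])
  have hS: "hermitian (herm_fun (\<lambda>x. 2 * sinh (x / 2)) L)" by (rule hermitian_herm_fun[OF L])
  have diag: "U ** (real_diag a ** C ** real_diag b) ** adjoint_mat V
      = (U ** real_diag a ** adjoint_mat U) ** (V ** real_diag b ** adjoint_mat V)" for a b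
    by (simp add: C_def matrix_mul_assoc)
  have "Y = real_diag p ** C - C ** real_diag q"
    by (simp add: Y_def vec_eq_iff real_diag_mult_left real_diag_mult_right algebra_simps)
  then have "U ** Y ** adjoint_mat V = U ** real_diag p ** (C ** adjoint_mat V) - (U ** C) ** real_diag q ** adjoint_mat V"
    by (simp add: matrix_diff_ldistrib matrix_diff_rdistrib matrix_mul_assoc)
  then have YD: "U ** Y ** adjoint_mat V = D"
    by (simp add: UC CV D_def U(2) V(2))
  have "N = real_diag (\<lambda>i. exp (1 / 2 * p i)) ** C ** real_diag (\<lambda>j. exp (- 1 / 2 * q j))
     - real_diag (\<lambda>i. exp (- 1 / 2 * p i)) ** C ** real_diag (\<lambda>j. exp (1 / 2 * q j))"
    unfolding N_def
    by (simp add: vec_eq_iff real_diag_mult_left real_diag_mult_right sinh_field_def diff_divide_distrib exp_diff exp_minus)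
       (simp add: field_simps)
  then have "U ** N ** adjoint_mat V = herm_exp (1/2) P ** herm_exp (-1/2) Q - herm_exp (-1/2) P ** herm_exp (1/2) Q"
    by (simp only: matrix_diff_ldistrib matrix_diff_rdistrib diag U(2) V(2) herm_fun_diag[OF U(1)] herm_fun_diag[OF V(1)])
  then have NW: "U ** N ** adjoint_mat V = W2 ** herm_fun (\<lambda>x. 2 * sinh (x / 2)) L ** adjoint_mat W1"
    using W(3) by simp
  have "trace_fun f (dilation N) = trace_fun f (dilation (U ** N ** adjoint_mat V))"
    by (rule trace_fun_dilation_conj[OF U(1) V(1), symmetric])
  also have "\<dots> = trace_fun f (dilation (herm_fun (\<lambda>x. 2 * sinh (x / 2)) L))"
    unfolding NW by (rule trace_fun_dilation_conj[OF W(2,1)])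
  also have "\<dots> = 2 * R"
    unfolding R_def by (simp add: trace_fun_dilation_even[where f = f, OF hS f] trace_fun_herm_fun[OF L])
  finally have N2R: "trace_fun f (dilation N) = 2 * R" .
  \<comment> \<open>The eigenvalues of the block diagonal matrix with the blocks \<open>P\<close> and \<open>Q\<close>.\<close>
  define r where "r = case_sum p q"
  define m where "m k i j = 1 + 1 / (4 * pi\<^sup>2 * (real k)\<^sup>2) * (r i - r j)\<^sup>2" for k i j
  have lim: "(\<lambda>n. of_real (\<Prod>k=1..n. m k (Inl i) (Inr j)) * Y $ i $ j) \<longlonglongrightarrow> N $ i $ j" for i j
  proof -
    have "(\<lambda>n. (p i - q j) * (\<Prod>k=1..n. m k (Inl i) (Inr j))) \<longlonglongrightarrow> 2 * sinh ((p i - q j) / 2)"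
      using sinh_product[of "p i - q j"] by (simp add: m_def r_def)
    from tendsto_mult[OF tendsto_of_real[OF this] tendsto_const[of "C $ i $ j"]]
    have "(\<lambda>n. complex_of_real ((p i - q j) * (\<Prod>k=1..n. m k (Inl i) (Inr j))) * C $ i $ j)
        \<longlonglongrightarrow> of_real (2 * sinh ((p i - q j) / 2)) * C $ i $ j" .
    then show ?thesis by (simp add: Y_def N_def mult_ac)
  qed
  have msym: "m k i j = m k j i" for k i j by (simp add: m_def power2_commute)
  have limB: "(\<lambda>n. of_real (\<Prod>k=1..n. m k s t) * dilation Y $ s $ t) \<longlonglongrightarrow> dilation N $ s $ t" for s t
  proof (cases s; cases t)
    fix i j assume "s = Inr i" "t = Inl j"
    then show ?thesis
      using tendsto_cnj[OF lim[of j i]] by (simp add: dilation_def adjoint_mat_nth msym[of _ "Inr i"])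
  qed (use lim in \<open>auto simp: dilation_def\<close>)
  have m1: "m 1 = (\<lambda>i j. 1 + 1 / (4 * pi\<^sup>2) * (r i - r j)\<^sup>2)" by (intro ext) (simp add: m_def)
  have le: "trace_fun f (schur_multiplier (m 1) (dilation Y)) \<le> 2 * R"
    unfolding N2R[symmetric] m_def
    by (rule trace_fun_sinh_multiplier[OF hermitian_dilation hermitian_dilation fg limB[unfolded m_def]])
  have "trace_fun f (dilation Y) \<le> trace_fun f (schur_multiplier (m 1) (dilation Y))"
    unfolding m1 by (rule trace_fun_quadratic_multiplier[OF hermitian_dilation fg]) simp
  moreover have "trace_fun f (dilation Y) = 2 * trace_fun f D"
    using trace_fun_dilation_conj[OF U(1) V(1), of f Y] trace_fun_dilation_even[where f = f, OF D f]
    by (simp only: YD)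
  ultimately show "trace_fun f D \<le> R" using le by simp
  have Y2: "derivation_sq P Q D = U ** (\<chi> i j. of_real ((p i - q j)\<^sup>2) * Y $ i $ j) ** adjoint_mat V"
  proof -
    have step: "P ** (U ** Z ** adjoint_mat V) - (U ** Z ** adjoint_mat V) ** Q
        = U ** (\<chi> i j. of_real (p i - q j) * Z $ i $ j) ** adjoint_mat V" for Z
    proof -
      have "(\<chi> i j. of_real (p i - q j) * Z $ i $ j) = real_diag p ** Z - Z ** real_diag q"
        by (simp add: vec_eq_iff real_diag_mult_left real_diag_mult_right algebra_simps)
      moreover have "P ** (U ** Z ** adjoint_mat V) = U ** (real_diag p ** Z) ** adjoint_mat V"
        using unitary_cancel(3)[OF U(1)] by (simp add: U(2) matrix_mul_assoc)
      moreover have "(U ** Z ** adjoint_mat V) ** Q = U ** (Z ** real_diag q) ** adjoint_mat V"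
        using unitary_cancel(3)[OF V(1)] by (simp add: V(2) matrix_mul_assoc)
      ultimately show ?thesis by (simp add: matrix_diff_ldistrib matrix_diff_rdistrib)
    qed
    show ?thesis
      unfolding derivation_sq_def YD[symmetric] step by (simp add: power2_eq_square mult.assoc)
  qed
  have "X = U ** (\<chi> i j. of_real (1 + 1 / (4 * pi\<^sup>2) * (p i - q j)\<^sup>2) * Y $ i $ j) ** adjoint_mat V"
  proof -
    have "(\<chi> i j. of_real (1 + 1 / (4 * pi\<^sup>2) * (p i - q j)\<^sup>2) * Y $ i $ j)
      = Y + (1 / (4 * pi\<^sup>2)) *\<^sub>R (\<chi> i j. of_real ((p i - q j)\<^sup>2) * Y $ i $ j)"
      by (simp add: vec_eq_iff) (simp add: scaleR_conv_of_real algebra_simps)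
    then show ?thesis
      unfolding X_def Y2
      by (simp only: matrix_add_ldistrib matrix_add_rdistrib matrix_mult_scaleR YD)
  qed
  then have "trace_fun f (dilation X)
      = trace_fun f (dilation (\<chi> i j. of_real (1 + 1 / (4 * pi\<^sup>2) * (p i - q j)\<^sup>2) * Y $ i $ j))"
    by (simp add: trace_fun_dilation_conj[OF U(1) V(1)])
  also have "dilation (\<chi> i j. of_real (1 + 1 / (4 * pi\<^sup>2) * (p i - q j)\<^sup>2) * Y $ i $ j) = schur_multiplier (m 1) (dilation Y)"
    unfolding m1 by (simp add: vec_eq_iff forall_sum dilation_def schur_multiplier_def adjoint_mat_nth r_def power2_commute)
  finally show "trace_fun f (dilation X) \<le> 2 * R" using le by simp
qed

text \<open>Klein's inequality bounds the gain of the first factor from below by its linear part at \<open>P - Q\<close>. This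
bound depends polynomially on \<open>P\<close> and \<open>Q\<close> once \<open>P - Q\<close> is fixed, so it passes to limits.\<close>
lemma sinh_comparison_surplus:
  fixes P Q L T :: "'n::finite cmat"
  assumes P: "hermitian P" and Q: "hermitian Q" and L: "hermitian L"
    and eQ: "herm_fun exp Q = T ** adjoint_mat T"
    and eP: "herm_fun exp P = T ** herm_fun exp L ** adjoint_mat T"
    and fg: "subgradient f g" and f: "\<And>x. f (- x) = f x" and g: "\<And>x. g (- x) = - g x"
  shows "trace_fun f (P - Q) + 1 / (4 * pi\<^sup>2) * trace_pair (herm_fun g (P - Q)) (derivation_sq P Q (P - Q))
    \<le> trace_fun (\<lambda>x. f (2 * sinh (x / 2))) L"
proof -
  let ?D = "P - Q"
  let ?X = "?D + (1 / (4 * pi\<^sup>2)) *\<^sub>R derivation_sq P Q ?D"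
  have D: "hermitian ?D" by (rule hermitian_diff[OF P Q])
  have diff: "dilation ?X - dilation ?D = dilation (?X - ?D)"
    by (simp only: dilation_def block_diff adjoint_mat_diff diff_self)
  have "trace_fun f (dilation ?D) + trace_pair (herm_fun g (dilation ?D)) (dilation ?X - dilation ?D)
      \<le> trace_fun f (dilation ?X)"
    by (rule klein_inequality[OF hermitian_dilation hermitian_dilation fg])
  also have "trace_pair (herm_fun g (dilation ?D)) (dilation ?X - dilation ?D)
      = 2 * trace_pair (herm_fun g ?D) (?X - ?D)"
    unfolding diff herm_fun_dilation_odd[where g = g, OF D g] by (rule trace_pair_dilation[OF hermitian_herm_fun[OF D]])
  also have "trace_fun f (dilation ?X) \<le> 2 * trace_fun (\<lambda>x. f (2 * sinh (x / 2))) L"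
    by (rule sinh_comparison(2)[where f = f, OF P Q L eQ eP fg f])
  finally show ?thesis
    by (simp add: trace_fun_dilation_even[where f = f, OF D f] trace_pair_scaleR)
qed

section \<open>Commuting matrices\<close>

lemma commute_herm_fun:
  assumes A: "hermitian A" and comm: "A ** C = C ** A"
  shows "herm_fun f A ** C = C ** herm_fun f A"
proof -
  obtain U d where U: "unitary U" "A = U ** real_diag d ** adjoint_mat U"
    using hermitian_diagonalization[OF A] .
  define S where "S = adjoint_mat U ** C ** U"
  have C: "C = U ** S ** adjoint_mat U"
    by (simp add: S_def matrix_mul_assoc unitary_right[OF U(1)] unitary_cancel[OF U(1)])
  have l: "(U ** real_diag e ** adjoint_mat U) ** C = U ** (real_diag e ** S) ** adjoint_mat U"
    and r: "C ** (U ** real_diag e ** adjoint_mat U) = U ** (S ** real_diag e) ** adjoint_mat U" for e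
    using unitary_cancel(3)[OF U(1)] by (simp_all add: C matrix_mul_assoc)
  have "adjoint_mat U ** (A ** C) ** U = adjoint_mat U ** (C ** A) ** U" by (simp add: comm)
  moreover have strip: "adjoint_mat U ** (U ** Z ** adjoint_mat U) ** U = Z" for Z
    by (simp add: matrix_mul_assoc unitary_left[OF U(1)] unitary_cancel[OF U(1)])
  ultimately have "real_diag d ** S = S ** real_diag d"
    unfolding U(2) l r by simp
  then have "of_real (d i) * S $ i $ j = S $ i $ j * of_real (d j)" for i j
    by (metis real_diag_mult_left real_diag_mult_right)
  then have "S $ i $ j = 0 \<or> d i = d j" for i j
    by (metis mult.commute mult_cancel_left of_real_eq_iff)
  then have "of_real (f (d i)) * S $ i $ j = S $ i $ j * of_real (f (d j))" for i j
    by (metis mult.commute mult_zero_left)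
  then have "real_diag (\<lambda>i. f (d i)) ** S = S ** real_diag (\<lambda>i. f (d i))"
    unfolding vec_eq_iff real_diag_mult_left real_diag_mult_right by blast
  then show ?thesis
    unfolding U(2) herm_fun_diag[OF U(1)] l r by simp
qed

lemma commute_of_double_commutator_pairing:
  assumes D: "hermitian D" and Q: "hermitian Q"
    and g: "\<And>x y. x \<noteq> y \<Longrightarrow> 0 < (x - y) * (g x - g y)"
    and le: "trace_pair (herm_fun g D) (commutator Q (commutator Q D)) \<le> 0"
  shows "Q ** D = D ** Q"
proof -
  obtain V d where V: "unitary V" "D = V ** real_diag d ** adjoint_mat V"
    using hermitian_diagonalization[OF D] .
  let ?S = "adjoint_mat V ** Q ** V"
  let ?e = "\<lambda>k l. (cmod (?S $ k $ l))\<^sup>2 * ((d k - d l) * (g (d k) - g (d l)))"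
  have pos: "0 < (d k - d l) * (g (d k) - g (d l))" if "d k \<noteq> d l" for k l
    using g[OF that] .
  have nn: "0 \<le> ?e k l" for k l
  proof (cases "d k = d l")
    case False
    show ?thesis by (rule mult_nonneg_nonneg[OF zero_le_power2 less_imp_le[OF pos[OF False]]])
  qed simp
  have "(\<Sum>k\<in>UNIV. \<Sum>l\<in>UNIV. ?e k l) \<le> 0"
    using le unfolding double_commutator_pairing[OF Q V] .
  then have "(\<Sum>k\<in>UNIV. \<Sum>l\<in>UNIV. ?e k l) = 0"
    by (intro antisym sum_nonneg nn)
  then have z: "?e k l = 0" for k l
    by (simp add: sum_nonneg_eq_0_iff sum_nonneg nn)
  have "?S $ k $ l * of_real (d l) = of_real (d k) * ?S $ k $ l" for k l
    using z[of k l] pos[of k l] by (cases "d k = d l") auto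
  then have SD: "?S ** real_diag d = real_diag d ** ?S"
    unfolding vec_eq_iff real_diag_mult_left real_diag_mult_right by blast
  have "Q ** D = (V ** adjoint_mat V) ** Q ** (V ** real_diag d ** adjoint_mat V)"
    by (simp add: V unitary_right[OF V(1)])
  also have "\<dots> = V ** (?S ** real_diag d) ** adjoint_mat V"
    by (simp add: matrix_mul_assoc)
  also have "\<dots> = (V ** real_diag d ** adjoint_mat V) ** Q ** (V ** adjoint_mat V)"
    unfolding SD by (simp add: matrix_mul_assoc)
  also have "\<dots> = D ** Q" by (simp add: V unitary_right[OF V(1)])
  finally show ?thesis .
qed

section \<open>Rescaling\<close>

lemma subgradient_continuous:
  assumes "subgradient f g"
  shows "continuous_on UNIV f"
proof (rule convex_on_continuous[OF open_UNIV], rule convex_onI)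
  fix t x y :: real
  assume t: "0 < t" "t < 1"
  let ?z = "(1 - t) *\<^sub>R x + t *\<^sub>R y"
  have "(1 - t) * (f ?z + g ?z * (x - ?z)) \<le> (1 - t) * f x" "t * (f ?z + g ?z * (y - ?z)) \<le> t * f y"
    using assms t by (auto simp: subgradient_def intro!: mult_left_mono)
  then show "f ?z \<le> (1 - t) * f x + t * f y"
    by (simp add: algebra_simps)
qed simp

lemma subgradient_rescale:
  assumes "subgradient f g"
  shows "subgradient (\<lambda>x. f (c * x)) (\<lambda>x. c * g (c * x))"
  using assms unfolding subgradient_def by (metis right_diff_distrib mult.assoc mult.commute)

lemma scaleR_eq_herm_fun: "hermitian X \<Longrightarrow> c *\<^sub>R X = herm_fun (\<lambda>x. c * x) X"
  by (simp add: herm_fun_scaleR herm_fun_ident)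

lemma herm_fun_of_scaleR: "hermitian X \<Longrightarrow> herm_fun f (c *\<^sub>R X) = herm_fun (\<lambda>x. f (c * x)) X"
  by (simp add: scaleR_eq_herm_fun herm_fun_herm_fun)

lemma trace_fun_of_scaleR: "hermitian X \<Longrightarrow> trace_fun f (c *\<^sub>R X) = trace_fun (\<lambda>x. f (c * x)) X"
  by (simp add: trace_fun_def herm_fun_of_scaleR)

text \<open>Short geodesic steps do not see the difference between \<open>2 sinh (x/2)\<close> and \<open>x\<close>.\<close>
lemma trace_fun_rescaled_sinh_tendsto:
  assumes L: "hermitian L" and fg: "subgradient f g"
  shows "(\<lambda>m. trace_fun (\<lambda>x. f (real m * (2 * sinh (1 / real m * x / 2)))) L) \<longlonglongrightarrow> trace_fun f L"
proof -
  obtain U l where U: "unitary U" "L = U ** real_diag l ** adjoint_mat U"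
    using hermitian_diagonalization[OF L] .
  have "(\<lambda>m. real m * (2 * sinh (1 / real m * x / 2))) \<longlonglongrightarrow> x" for x
    unfolding sinh_field_def by real_asymp
  then have "(\<lambda>m. f (real m * (2 * sinh (1 / real m * x / 2)))) \<longlonglongrightarrow> f x" for x
    using subgradient_continuous[OF fg] by (auto intro: continuous_on_tendsto_compose)
  then show ?thesis
    unfolding U(2) trace_fun_diag[OF U(1)] by (intro tendsto_sum)
qed

section \<open>Positive definite matrices and their logarithms\<close>

lemma pos_def_eigenvalues:
  assumes "pos_def B" and U: "unitary U" "B = U ** real_diag d ** adjoint_mat U"
  shows "0 < d i"
proof -
  define x where "x = (\<chi> k. U $ k $ i)"
  have "(\<Sum>k\<in>UNIV. (cmod (x $ k))\<^sup>2) = 1"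
    using unitary_entry_sum(1)[OF U(1), of i] by (simp add: x_def)
  then have "x \<noteq> 0" by auto
  then have "0 < Re (\<Sum>k\<in>UNIV. cnj (x $ k) * (B *v x) $ k)"
    using assms(1) by (simp add: pos_def_def)
  also have "(\<Sum>k\<in>UNIV. cnj (x $ k) * (B *v x) $ k) = (adjoint_mat U ** (B ** U)) $ i $ i"
    by (simp add: x_def matrix_matrix_mult_def matrix_vector_mult_def adjoint_mat_nth)
  also have "adjoint_mat U ** (B ** U) = real_diag d"
    by (simp add: U(2) matrix_mul_assoc unitary_left[OF U(1)] unitary_cancel[OF U(1)])
  finally show ?thesis by (simp add: real_diag_def)
qed

lemma
  assumes B: "pos_def B"
  shows hermitian_mat_log: "hermitian (mat_log B)" and exp_mat_log: "herm_fun exp (mat_log B) = B"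
proof -
  have h: "hermitian B" using B by (simp add: pos_def_def)
  then show "hermitian (mat_log B)" by (simp add: mat_log_def hermitian_herm_fun)
  obtain U d where U: "unitary U" "B = U ** real_diag d ** adjoint_mat U"
    using hermitian_diagonalization[OF h] .
  have "exp (ln (d i)) = d i" for i using pos_def_eigenvalues[OF B U] by simp
  then show "herm_fun exp (mat_log B) = B"
    by (simp add: mat_log_def U herm_fun_diag)
qed

lemma mat_log_exp: "hermitian X \<Longrightarrow> mat_log (herm_fun exp X) = X"
  by (simp add: mat_log_def herm_fun_herm_fun herm_fun_ident)

lemma sum_cnj_mult_vec:
  "(\<Sum>i\<in>UNIV. cnj (x $ i) * (R *v y) $ i) = (\<Sum>j\<in>UNIV. cnj ((adjoint_mat R *v x) $ j) * y $ j)"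
  unfolding matrix_vector_mult_def
  by (simp add: sum_distrib_left sum_distrib_right adjoint_mat_nth) (subst sum.swap, simp add: mult_ac)

lemma pos_def_congruence:
  assumes B: "pos_def B" and S: "R ** S = mat 1"
  shows "pos_def (R ** B ** adjoint_mat R)"
  unfolding pos_def_def
proof (intro conjI allI impI)
  show "hermitian (R ** B ** adjoint_mat R)"
    using B by (simp add: pos_def_def hermitian_conj)
  fix x :: "complex ^ 'a" assume x: "x \<noteq> 0"
  let ?y = "adjoint_mat R *v x"
  have "adjoint_mat S ** adjoint_mat R = mat 1"
    using S by (simp flip: adjoint_mat_mult)
  then have "adjoint_mat S *v ?y = x" by (simp add: matrix_vector_mul_assoc)
  then have "?y \<noteq> 0" using x by auto
  then have "0 < Re (\<Sum>i\<in>UNIV. cnj (?y $ i) * (B *v ?y) $ i)"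
    using B by (simp add: pos_def_def)
  also have "(\<Sum>i\<in>UNIV. cnj (?y $ i) * (B *v ?y) $ i) = (\<Sum>i\<in>UNIV. cnj (x $ i) * ((R ** B ** adjoint_mat R) *v x) $ i)"
    by (simp add: sum_cnj_mult_vec[symmetric] flip: matrix_vector_mul_assoc)
  finally show "0 < Re (\<Sum>i\<in>UNIV. cnj (x $ i) * ((R ** B ** adjoint_mat R) *v x) $ i)" .
qed

lemma pos_def_one: "pos_def (mat 1 :: 'n::finite cmat)"
  unfolding pos_def_def
proof (intro conjI allI impI)
  show "hermitian (mat 1 :: 'n cmat)" by (simp add: hermitian_def)
  fix x :: "complex ^ 'n" assume "x \<noteq> 0"
  then obtain k where "x $ k \<noteq> 0" by (auto simp: vec_eq_iff)
  then have "0 < (\<Sum>i\<in>UNIV. (cmod (x $ i))\<^sup>2)"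
    by (intro sum_pos2[of _ k]) auto
  also have "\<dots> = Re (\<Sum>i\<in>UNIV. cnj (x $ i) * (mat 1 *v x) $ i)"
    by (simp add: cmod_power2) (simp add: power2_eq_square)
  finally show "0 < Re (\<Sum>i\<in>UNIV. cnj (x $ i) * (mat 1 *v x) $ i)" .
qed

section \<open>The exponential metric increasing property\<close>

text \<open>The geodesic is \<open>t \<mapsto> T exp(tL) T\<^sup>*\<close>. Its point at \<open>k/m\<close> is \<open>S S\<^sup>*\<close> with
\<open>S = T exp(kL/2m)\<close>, and \<open>K k\<close> is its logarithm; in the coordinates given by \<open>S\<close>, each step is
\<open>L/m\<close>.\<close>
lemma geodesic_subdivision:
  fixes P Q L T :: "'n::finite cmat" and m :: nat
  assumes P: "hermitian P" and Q: "hermitian Q" and L: "hermitian L"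
    and eQ: "herm_fun exp Q = T ** adjoint_mat T"
    and eP: "herm_fun exp P = T ** herm_fun exp L ** adjoint_mat T"
    and m: "0 < m"
  obtains K S where "K 0 = Q" "K m = P" "S 0 = T" "\<And>k. hermitian (K k)"
    "\<And>k. herm_fun exp (K k) = S k ** adjoint_mat (S k)"
    "\<And>k. herm_fun exp (K (Suc k)) = S k ** herm_fun exp ((1 / real m) *\<^sub>R L) ** adjoint_mat (S k)"
proof -
  define S where "S k = T ** herm_exp (real k / (2 * real m)) L" for k
  define K where "K k = mat_log (S k ** adjoint_mat (S k))" for k
  have "T ** (adjoint_mat T ** herm_exp (- 1) Q) = mat 1"
    using herm_exp_cancel[OF Q, of 1 "-1"] by (simp add: matrix_mul_assoc flip: eQ)
  moreover have "herm_exp a L ** herm_exp (- a) L = mat 1" for a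
    by (rule herm_exp_cancel[OF L]) simp
  ultimately have inv: "S k ** (herm_exp (- (real k / (2 * real m))) L ** (adjoint_mat T ** herm_exp (- 1) Q)) = mat 1" for k
    unfolding S_def by (metis matrix_mul_assoc matrix_mul_rid)
  have pd: "pos_def (S k ** adjoint_mat (S k))" for k
    using pos_def_congruence[OF pos_def_one inv[of k]] by simp
  have SS: "S k ** herm_exp a L ** adjoint_mat (S k) = T ** herm_exp (real k / real m + a) L ** adjoint_mat T" for k a
  proof -
    have "S k ** herm_exp a L ** adjoint_mat (S k)
      = T ** (herm_exp (real k / (2 * real m)) L ** herm_exp a L ** herm_exp (real k / (2 * real m)) L) ** adjoint_mat T"
      by (simp add: S_def adjoint_mat_mult adjoint_herm_fun L matrix_mul_assoc)
    moreover have "herm_exp (real k / (2 * real m)) L ** herm_exp a L ** herm_exp (real k / (2 * real m)) L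
      = herm_exp (real k / (2 * real m) + a + real k / (2 * real m)) L"
      by (simp only: herm_exp_add[OF L])
    moreover have "real k / (2 * real m) + a + real k / (2 * real m) = real k / real m + a"
      using m by (simp add: field_simps)
    ultimately show ?thesis by (simp only:)
  qed
  have SS0: "S k ** adjoint_mat (S k) = T ** herm_exp (real k / real m) L ** adjoint_mat T" for k
    using SS[of k 0] by (simp add: herm_fun_one L)
  have 0: "K 0 = Q"
    unfolding K_def SS0 by (simp add: herm_fun_one L mat_log_exp Q flip: eQ)
  have M: "K m = P"
    unfolding K_def SS0 using m by (simp add: mat_log_exp P flip: eP)
  have S0: "S 0 = T" by (simp add: S_def herm_fun_one L)
  have hK: "hermitian (K k)" for k unfolding K_def by (rule hermitian_mat_log[OF pd])
  have eK: "herm_fun exp (K k) = S k ** adjoint_mat (S k)" for k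
    unfolding K_def by (rule exp_mat_log[OF pd])
  have "herm_fun exp (K (Suc k)) = S k ** herm_fun exp ((1 / real m) *\<^sub>R L) ** adjoint_mat (S k)" for k
    unfolding eK SS0[of "Suc k"] herm_fun_of_scaleR[OF L] SS by (simp add: add_divide_distrib add.commute)
  from that[OF 0 M S0 hK eK this] show ?thesis .
qed

lemma trace_pair_sum: "trace_pair X (sum Y A) = (\<Sum>k\<in>A. trace_pair X (Y k))"
proof (induction A rule: infinite_finite_induct)
  case (insert a A) then show ?case by (simp add: trace_pair_add)
qed (simp_all add: trace_pair_def trace_def matrix_matrix_mult_def)

text \<open>If \<open>Z\<close> is the mean of the \<open>Y k\<close>, the linear terms cancel, so the gaps in Klein's inequality sum to the defect in Jensen's
inequality.\<close>
lemma klein_average: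
  fixes Y :: "nat \<Rightarrow> 'n::finite cmat"
  assumes sum: "(\<Sum>k<m. Y k) = real m *\<^sub>R Z"
  shows "(\<Sum>k<m. trace_fun f (Y k) - trace_fun f Z - trace_pair (herm_fun g Z) (Y k - Z))
    = (\<Sum>k<m. trace_fun f (Y k)) - real m * trace_fun f Z"
proof -
  have "(\<Sum>k<m. trace_pair (herm_fun g Z) (Y k - Z)) = 0"
    by (simp add: trace_pair_diff sum_subtractf sum trace_pair_scaleR flip: trace_pair_sum)
  then show ?thesis by (simp add: sum_subtractf)
qed

text \<open>The mean of the \<open>m\<close> differences \<open>Y k\<close> of logarithms along the geodesic is \<open>Z = (P - Q)/m\<close>, and each of
them obeys \<open>sinh_comparison\<close> with \<open>L/m\<close>. Rescaling \<open>f\<close> by \<open>m\<close> gives bounds that converge as \<open>m\<close> grows.\<close>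
lemma exponential_metric_increasing:
  fixes P Q L T :: "'n::finite cmat"
  assumes P: "hermitian P" and Q: "hermitian Q" and L: "hermitian L"
    and eQ: "herm_fun exp Q = T ** adjoint_mat T"
    and eP: "herm_fun exp P = T ** herm_fun exp L ** adjoint_mat T"
    and fg: "subgradient f g" and f: "\<And>x. f (- x) = f x"
  shows "trace_fun f (P - Q) \<le> trace_fun f L"
proof (rule LIMSEQ_le_const[OF trace_fun_rescaled_sinh_tendsto[OF L fg]], intro exI allI impI)
  fix m :: nat assume "1 \<le> m"
  then have m: "0 < m" by simp
  obtain K S where K: "K 0 = Q" "K m = P" and hK: "\<And>k. hermitian (K k)"
    and eK: "\<And>k. herm_fun exp (K k) = S k ** adjoint_mat (S k)"
    and eK': "\<And>k. herm_fun exp (K (Suc k)) = S k ** herm_fun exp ((1 / real m) *\<^sub>R L) ** adjoint_mat (S k)"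
    using geodesic_subdivision[OF P Q L eQ eP m] by metis
  define Y where "Y k = K (Suc k) - K k" for k
  define Z where "Z = (1 / real m) *\<^sub>R (P - Q)"
  let ?f = "\<lambda>x. f (real m * x)" and ?g = "\<lambda>x. real m * g (real m * x)"
  let ?R = "trace_fun (\<lambda>x. f (real m * (2 * sinh (1 / real m * x / 2)))) L"
  have fg': "subgradient ?f ?g" by (rule subgradient_rescale[OF fg])
  have f': "?f (- x) = ?f x" for x by (simp add: f)
  have hY: "hermitian (Y k)" for k unfolding Y_def by (rule hermitian_diff[OF hK hK])
  have hZ: "hermitian Z" unfolding Z_def by (intro hermitian_scaleR hermitian_diff P Q)
  have fZ: "trace_fun ?f Z = trace_fun f (P - Q)"
    unfolding Z_def using m by (simp add: trace_fun_of_scaleR hermitian_diff P Q)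
  have sum: "(\<Sum>k<m. Y k) = real m *\<^sub>R Z"
    using m by (simp add: Y_def Z_def sum_lessThan_telescope K)
  have "0 \<le> trace_fun ?f (Y k) - trace_fun ?f Z - trace_pair (herm_fun ?g Z) (Y k - Z)" for k
    using klein_inequality[OF hY hZ fg', of k] by linarith
  then have "real m * trace_fun ?f Z \<le> (\<Sum>k<m. trace_fun ?f (Y k))"
    using klein_average[OF sum, of ?f ?g] sum_nonneg[of "{..<m}"] by (smt (verit))
  also have "\<dots> \<le> (\<Sum>k<m. ?R)"
  proof (rule sum_mono)
    fix k
    have "trace_fun ?f (K (Suc k) - K k) \<le> trace_fun (\<lambda>x. ?f (2 * sinh (x / 2))) ((1 / real m) *\<^sub>R L)"
      by (rule sinh_comparison(1)[where f = ?f, OF hK hK hermitian_scaleR[OF L] eK eK' fg' f'])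
    also have "\<dots> = ?R" by (simp add: trace_fun_of_scaleR[OF L])
    finally show "trace_fun ?f (Y k) \<le> ?R" unfolding Y_def .
  qed
  finally show "trace_fun f (P - Q) \<le> ?R"
    using m by (simp add: fZ)
qed

section \<open>The case of equality\<close>

lemma derivation_sq_scaleR: "derivation_sq P Q (c *\<^sub>R X) = c *\<^sub>R derivation_sq P Q X"
  by (simp add: derivation_sq_def matrix_mult_scaleR flip: scaleR_diff_right)

lemma derivation_sq_expansion:
  "derivation_sq (Q + c *\<^sub>R D) Q D = commutator Q (commutator Q D)
    + c *\<^sub>R (Q ** (D ** D) + D ** commutator Q D - D ** D ** Q) + c\<^sup>2 *\<^sub>R (D ** (D ** D))"
  by (simp add: derivation_sq_def commutator_def matrix_add_ldistrib matrix_add_rdistrib matrix_diff_ldistrib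
      matrix_diff_rdistrib matrix_mult_scaleR matrix_mul_assoc power2_eq_square algebra_simps)

text \<open>Apply the inequality to each of the \<open>m\<close> steps. Equality for the whole geodesic forces equality in Jensen's
inequality, hence all differences \<open>Y k\<close> equal their mean. The statement records this for the first step.\<close>
lemma log_linear_of_equality:
  fixes P Q L T :: "'n::finite cmat" and m :: nat
  assumes P: "hermitian P" and Q: "hermitian Q" and L: "hermitian L"
    and eQ: "herm_fun exp Q = T ** adjoint_mat T"
    and eP: "herm_fun exp P = T ** herm_fun exp L ** adjoint_mat T"
    and fg: "\<And>x y. x \<noteq> y \<Longrightarrow> f y + g y * (x - y) < f x" and f: "\<And>x. f (- x) = f x"
    and eq: "trace_fun f L \<le> trace_fun f (P - Q)" and m: "0 < m"
  shows "herm_fun exp (Q + (1 / real m) *\<^sub>R (P - Q)) = T ** herm_fun exp ((1 / real m) *\<^sub>R L) ** adjoint_mat T"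
proof -
  obtain K S where K: "K 0 = Q" "K m = P" and S0: "S 0 = T" and hK: "\<And>k. hermitian (K k)"
    and eK: "\<And>k. herm_fun exp (K k) = S k ** adjoint_mat (S k)"
    and eK': "\<And>k. herm_fun exp (K (Suc k)) = S k ** herm_fun exp ((1 / real m) *\<^sub>R L) ** adjoint_mat (S k)"
    using geodesic_subdivision[OF P Q L eQ eP m] by metis
  define Y where "Y k = K (Suc k) - K k" for k
  define Z where "Z = (1 / real m) *\<^sub>R (P - Q)"
  let ?f = "\<lambda>x. f (real m * x)" and ?g = "\<lambda>x. real m * g (real m * x)"
  have fg_strict: "?f y + ?g y * (x - y) < ?f x" if "x \<noteq> y" for x y
    using fg[of "real m * x" "real m * y"] that m by (simp add: algebra_simps)
  then have fg': "subgradient ?f ?g"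
    unfolding subgradient_def by (metis add_0_right diff_self less_imp_le mult_zero_right order_refl)
  have f': "?f (- x) = ?f x" for x by (simp add: f)
  have hY: "hermitian (Y k)" for k unfolding Y_def by (rule hermitian_diff[OF hK hK])
  have hZ: "hermitian Z" unfolding Z_def by (intro hermitian_scaleR hermitian_diff P Q)
  have fZ: "trace_fun ?f Z = trace_fun f (P - Q)"
    unfolding Z_def using m by (simp add: trace_fun_of_scaleR hermitian_diff P Q)
  have sum: "(\<Sum>k<m. Y k) = real m *\<^sub>R Z"
    using m by (simp add: Y_def Z_def sum_lessThan_telescope K)
  let ?gap = "\<lambda>k. trace_fun ?f (Y k) - trace_fun ?f Z - trace_pair (herm_fun ?g Z) (Y k - Z)"
  have gap: "0 \<le> ?gap k" for k
    using klein_inequality[OF hY hZ fg', of k] by linarith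
  have "trace_fun ?f (Y k) \<le> trace_fun ?f Z" for k
  proof -
    have "trace_fun ?f (K (Suc k) - K k) \<le> trace_fun ?f ((1 / real m) *\<^sub>R L)"
      by (rule exponential_metric_increasing[where f = ?f, OF hK hK hermitian_scaleR[OF L] eK eK' fg' f'])
    also have "\<dots> = trace_fun f L" using m by (simp add: trace_fun_of_scaleR[OF L])
    finally show ?thesis using eq by (simp add: Y_def fZ)
  qed
  then have "(\<Sum>k<m. trace_fun ?f (Y k)) \<le> (\<Sum>k<m. trace_fun ?f Z)"
    by (intro sum_mono)
  then have "(\<Sum>k<m. ?gap k) \<le> 0"
    using klein_average[OF sum, of ?f ?g] by simp
  then have "(\<Sum>k<m. ?gap k) = 0"
    by (intro antisym sum_nonneg gap)
  then have "?gap 0 = 0"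
    using sum_nonneg_eq_0_iff[of "{..<m}" ?gap] gap m by auto
  then have "Y 0 = Z"
    by (intro klein_equality[where f = ?f and g = ?g, OF hY hZ fg_strict]) auto
  then have "K (Suc 0) = Q + (1 / real m) *\<^sub>R (P - Q)"
    by (simp add: Y_def Z_def K algebra_simps)
  with eK'[of 0] show ?thesis by (simp add: S0)
qed

text \<open>By \<open>log_linear_of_equality\<close>, the surplus in \<open>sinh_comparison_surplus\<close> for the first of \<open>m\<close> steps is an
explicit polynomial in \<open>1/m\<close> with constant term \<open>a0 = Tr (g(D) [Q, [Q, D]])\<close>, and as \<open>m\<close> grows there is no room left
for it.\<close>
lemma commute_of_equality:
  fixes P Q L T :: "'n::finite cmat"
  assumes P: "hermitian P" and Q: "hermitian Q" and L: "hermitian L"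
    and eQ: "herm_fun exp Q = T ** adjoint_mat T"
    and eP: "herm_fun exp P = T ** herm_fun exp L ** adjoint_mat T"
    and fg: "\<And>x y. x \<noteq> y \<Longrightarrow> f y + g y * (x - y) < f x"
    and f: "\<And>x. f (- x) = f x" and g: "\<And>x. g (- x) = - g x"
    and eq: "trace_fun f L \<le> trace_fun f (P - Q)"
  shows "P ** Q = Q ** P"
proof -
  define D where "D = P - Q"
  define a0 where "a0 = trace_pair (herm_fun g D) (commutator Q (commutator Q D))"
  define a1 where "a1 = trace_pair (herm_fun g D) (Q ** (D ** D) + D ** commutator Q D - D ** D ** Q)"
  define a2 where "a2 = trace_pair (herm_fun g D) (D ** (D ** D))"
  have D: "hermitian D" unfolding D_def by (rule hermitian_diff[OF P Q])
  have tan: "subgradient f g"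
    unfolding subgradient_def by (metis fg add_0_right diff_self less_imp_le mult_zero_right order_refl)
  have bound: "trace_fun f D + 1 / (4 * pi\<^sup>2) * (a0 + 1 / real m * a1 + (1 / real m)\<^sup>2 * a2)
      \<le> trace_fun (\<lambda>x. f (real m * (2 * sinh (1 / real m * x / 2)))) L" if "0 < m" for m :: nat
  proof -
    let ?c = "1 / real m"
    let ?f = "\<lambda>x. f (real m * x)" and ?g = "\<lambda>x. real m * g (real m * x)"
    let ?P = "Q + ?c *\<^sub>R D"
    have PQ: "?P - Q = ?c *\<^sub>R D" by simp
    have f': "?f (- x) = ?f x" and g': "?g (- x) = - ?g x" for x by (simp_all add: f g)
    have hP: "hermitian ?P" by (intro hermitian_add hermitian_scaleR Q D)
    have "herm_fun exp ?P = T ** herm_fun exp (?c *\<^sub>R L) ** adjoint_mat T"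
      unfolding D_def by (rule log_linear_of_equality[where f = f and g = g, OF P Q L eQ eP fg f eq that])
    note sinh_comparison_surplus[where f = ?f and g = ?g, OF hP Q hermitian_scaleR[OF L] eQ this subgradient_rescale[OF tan] f' g']
    also have "trace_fun (\<lambda>x. ?f (2 * sinh (x / 2))) (?c *\<^sub>R L)
        = trace_fun (\<lambda>x. f (real m * (2 * sinh (1 / real m * x / 2)))) L"
      by (simp add: trace_fun_of_scaleR[OF L])
    also have "trace_fun ?f (?P - Q) = trace_fun f D"
      unfolding PQ using that by (simp add: trace_fun_of_scaleR[OF D])
    also have "herm_fun ?g (?P - Q) = real m *\<^sub>R herm_fun g D"
      unfolding PQ using that by (simp add: herm_fun_of_scaleR[OF D] herm_fun_scaleR[OF D])
    also have "derivation_sq ?P Q (?P - Q) = ?c *\<^sub>R derivation_sq ?P Q D"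
      unfolding PQ by (rule derivation_sq_scaleR)
    also have "trace_pair (real m *\<^sub>R herm_fun g D) (?c *\<^sub>R derivation_sq ?P Q D)
        = trace_pair (herm_fun g D) (derivation_sq ?P Q D)"
      using that by (subst trace_pair_commute)
        (simp add: trace_pair_scaleR trace_pair_commute[of "_ *\<^sub>R _"] trace_pair_commute[of "herm_fun g D"])
    also have "\<dots> = a0 + ?c * a1 + ?c\<^sup>2 * a2"
      unfolding derivation_sq_expansion trace_pair_add trace_pair_scaleR a0_def a1_def a2_def ..
    finally show ?thesis .
  qed
  have inv: "(\<lambda>m. 1 / real m) \<longlonglongrightarrow> 0" by (rule lim_1_over_n)
  have "(\<lambda>m. trace_fun f D + 1 / (4 * pi\<^sup>2) * (a0 + 1 / real m * a1 + (1 / real m)\<^sup>2 * a2))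
      \<longlonglongrightarrow> trace_fun f D + 1 / (4 * pi\<^sup>2) * (a0 + 0 * a1 + 0\<^sup>2 * a2)"
    by (intro tendsto_intros inv)
  then have "trace_fun f D + 1 / (4 * pi\<^sup>2) * (a0 + 0 * a1 + 0\<^sup>2 * a2) \<le> trace_fun f L"
    by (rule LIMSEQ_le[OF _ trace_fun_rescaled_sinh_tendsto[OF L tan]]) (use bound in \<open>auto intro!: exI[of _ 1]\<close>)
  with eq have "1 / (4 * pi\<^sup>2) * a0 \<le> 0" by (simp add: D_def)
  then have "a0 \<le> 0" by (simp add: field_simps)
  moreover have "0 < (x - y) * (g x - g y)" if "x \<noteq> y" for x y
    using fg[OF that] fg[OF that[symmetric]] by (simp add: algebra_simps)
  ultimately have "Q ** D = D ** Q"
    unfolding a0_def by (intro commute_of_double_commutator_pairing[OF D Q])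
  then show ?thesis by (simp add: D_def matrix_diff_ldistrib matrix_diff_rdistrib)
qed

section \<open>The Schatten norm\<close>

text \<open>By the symmetry \<open>x \<mapsto> -x\<close> it suffices to treat \<open>y > 0\<close>. There the mean value theorem settles \<open>x > 0\<close>, and
for \<open>x \<le> 0\<close> the supporting line is already negative.\<close>
lemma abs_powr_strict_subgradient:
  fixes p :: real
  assumes p: "1 < p" and xy: "x \<noteq> y"
  shows "\<bar>y\<bar> powr p + p * sgn y * \<bar>y\<bar> powr (p - 1) * (x - y) < \<bar>x\<bar> powr p"
proof -
  have pos: "y powr p + p * y powr (p - 1) * (x - y) < \<bar>x\<bar> powr p" if y: "0 < y" and xy: "x \<noteq> y" for x y
  proof -
    have der: "((\<lambda>t. t powr p) has_real_derivative p * t powr (p - 1)) (at t)" if "0 < t" for t :: real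
      using has_real_derivative_powr[OF that] by simp
    have mono: "p * s powr (p - 1) < p * t powr (p - 1)" if "0 < s" "s < t" for s t :: real
      using p that by (simp add: powr_less_mono2)
    consider "y < x" | "0 < x" "x < y" | "x \<le> 0" using xy by linarith
    then show ?thesis
    proof cases
      case 1
      obtain z where z: "y < z" "x powr p - y powr p = (x - y) * (p * z powr (p - 1))"
        using MVT2[OF 1, of "\<lambda>t. t powr p" "\<lambda>t. p * t powr (p - 1)"] der y by fastforce
      have "(x - y) * (p * y powr (p - 1)) < (x - y) * (p * z powr (p - 1))"
        using mono[OF y z(1)] 1 by (simp add: mult_strict_left_mono)
      then show ?thesis using z(2) 1 y by (simp add: algebra_simps)
    next
      case 2
      obtain z where z: "x < z" "z < y" "y powr p - x powr p = (y - x) * (p * z powr (p - 1))"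
        using MVT2[OF 2(2), of "\<lambda>t. t powr p" "\<lambda>t. p * t powr (p - 1)"] der 2 by fastforce
      have "(y - x) * (p * z powr (p - 1)) < (y - x) * (p * y powr (p - 1))"
        using mono[of z y] z 2 by (simp add: mult_strict_left_mono)
      then show ?thesis using z(3) 2 by (simp add: algebra_simps)
    next
      case 3
      have "y powr p = y * y powr (p - 1)" using y by (simp add: powr_mult_base)
      then have "y powr p + p * y powr (p - 1) * (x - y) = y powr (p - 1) * ((1 - p) * y + p * x)"
        by (simp add: algebra_simps)
      also have "(1 - p) * y < 0" using p y by (simp add: mult_less_0_iff)
      then have "(1 - p) * y + p * x < 0" using p 3 by (simp add: mult_nonneg_nonpos add_neg_nonpos)
      then have "y powr (p - 1) * ((1 - p) * y + p * x) < 0" using y by (simp add: mult_pos_neg)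
      also have "0 \<le> \<bar>x\<bar> powr p" by simp
      finally show ?thesis .
    qed
  qed
  consider "y = 0" | "0 < y" | "y < 0" by linarith
  then show ?thesis
  proof cases
    case 1 then show ?thesis using xy by simp
  next
    case 2 then show ?thesis using pos[OF 2 xy] by simp
  next
    case 3
    then show ?thesis using pos[of "- y" "- x"] xy by (simp add: algebra_simps)
  qed
qed

lemma schatten_norm_hermitian:
  assumes X: "hermitian X"
  shows "schatten_norm p X = trace_fun (\<lambda>x. \<bar>x\<bar> powr p) X powr (1 / p)"
proof -
  have "adjoint_mat X ** X = herm_fun (\<lambda>x. x * x) X"
    using X herm_fun_mult[OF X, of "\<lambda>x. x" "\<lambda>x. x"] by (simp add: herm_fun_ident hermitian_def)
  then have "mat_powr (mat_abs X) p = herm_fun (\<lambda>x. \<bar>x\<bar> powr p) X"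
    by (simp add: mat_abs_def mat_powr_def herm_fun_herm_fun X)
  then show ?thesis by (simp add: schatten_norm_def trace_fun_def)
qed

theorem theorem2p3:
  fixes A B :: "complex ^ 'n::finite ^ 'n" and p :: real
  assumes "pos_def A" and "pos_def B"
    and "commutator A B \<noteq> 0"
    and "p > 1"
  shows "delta p A B > schatten_norm p (mat_log A - mat_log B)"
proof -
  let ?f = "\<lambda>x. \<bar>x\<bar> powr p" and ?g = "\<lambda>x. p * sgn x * \<bar>x\<bar> powr (p - 1)"
  define H where "H = mat_log A"
  define K where "K = mat_log B"
  define R where "R = herm_exp (-1/2) H"
  define T where "T = herm_exp (1/2) H"
  define L where "L = mat_log (R ** B ** R)"
  have H: "hermitian H" "herm_fun exp H = A" and K: "hermitian K" "herm_fun exp K = B"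
    unfolding H_def K_def by (simp_all add: hermitian_mat_log exp_mat_log assms)
  have T: "adjoint_mat T = T" and R: "adjoint_mat R = R"
    unfolding T_def R_def by (simp_all only: adjoint_herm_fun[OF H(1)])
  have RT: "R ** T = mat 1" and TR: "T ** R = mat 1"
    unfolding T_def R_def by (rule herm_exp_cancel[OF H(1)], simp)+
  have "mat_powr A (- 1 / 2) = R"
    unfolding mat_powr_def H(2)[symmetric] R_def by (simp add: herm_fun_herm_fun[OF H(1)] powr_def)
  then have delta: "delta p A B = schatten_norm p L"
    by (simp only: delta_def L_def)
  have "pos_def (R ** B ** R)"
    using pos_def_congruence[OF assms(2) RT] by (simp only: R)
  then have L: "hermitian L" "herm_fun exp L = R ** B ** R"
    unfolding L_def by (simp_all only: hermitian_mat_log exp_mat_log)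
  have eA: "herm_fun exp H = T ** adjoint_mat T"
    unfolding T unfolding T_def using herm_exp_add[OF H(1), of "1/2" "1/2"] by simp
  have "T ** (R ** B ** R) ** T = (T ** R) ** B ** (R ** T)"
    by (simp only: matrix_mul_assoc)
  then have eB: "herm_fun exp K = T ** herm_fun exp L ** adjoint_mat T"
    by (simp add: T L K RT TR)
  have lt: "trace_fun ?f (K - H) < trace_fun ?f L"
  proof (rule ccontr)
    assume "\<not> trace_fun ?f (K - H) < trace_fun ?f L"
    then have "K ** H = H ** K"
      by (intro commute_of_equality[where f = ?f and g = ?g, OF K(1) H(1) L(1) eA eB abs_powr_strict_subgradient[OF assms(4)]])
         auto
    then have "B ** H = H ** B"
      using commute_herm_fun[OF K(1), of H exp] K(2) by simp
    then have "A ** B = B ** A"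
      using commute_herm_fun[OF H(1), of B exp] H(2) by simp
    then show False using assms(3) by (simp add: commutator_def)
  qed
  have HK: "hermitian (H - K)" and KH: "hermitian (K - H)" by (intro hermitian_diff H K)+
  have "H - K = (- 1) *\<^sub>R (K - H)" by simp
  then have "trace_fun ?f (H - K) = trace_fun ?f (K - H)"
    by (simp only: trace_fun_of_scaleR[OF KH]) simp
  then have lt': "trace_fun ?f (H - K) < trace_fun ?f L" using lt by simp
  obtain U d where U: "unitary U" "H - K = U ** real_diag d ** adjoint_mat U"
    using hermitian_diagonalization[OF HK] .
  have "0 \<le> trace_fun ?f (H - K)"
    unfolding U(2) trace_fun_diag[OF U(1)] by (intro sum_nonneg) simp
  then have "trace_fun ?f (H - K) powr (1 / p) < trace_fun ?f L powr (1 / p)"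
    using lt' assms(4) by (intro powr_less_mono2) auto
  then show ?thesis
    unfolding delta schatten_norm_hermitian[OF L(1)] using schatten_norm_hermitian[OF HK, of p]
    by (simp add: H_def K_def)
qed

end
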